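(* The class of strict-interval ABPs is equivalent to the class of ROABPs up to polynomial size blow-up: every polynomial computed by a strict-interval ABP of size $S$ is computed by a ROABP of size polynomial in $S$ (indeed $O(S^2)$), and every polynomial computed by a ROABP is computed by a strict-interval ABP of polynomial size.
   Context: $X=\{x_1,\ldots,x_n\}$. An ABP is a layered DAG with source $s$ and sink $t$, edges labeled by elements of $X\cup\mathbb{F}$, computing the sum over $s$–$t$ paths of products of edge labels; size is the number of nodes; for nodes $u,v$, $[u,v]_P$ denotes the sub-program from $u$ to $v$. It is syntactic multilinear if every $s$–$t$ path reads each variable at most once. For a permutation $\pi\in S_n$, a $\pi$-interval of variables is a subset of $\{x_{\pi(i)},x_{\pi(i+1)},\ldots,x_{\pi(j)}\}$ for some $i<j$. A strict-interval ABP is a syntactic multilinear ABP $P$ together with a permutation $\pi$ such that (1) for every pair of nodes $u,v$, the variables occurring in $[u,v]_P$ are contained in some $\pi$-interval $I_{uv}$, and (2) for every pair of sub-programs $[u,v]_P,[v,w]_P$, $I_{uv}\cap I_{vw}=\emptyset$. A ROABP is a syntactic multilinear ABP in which each layer reads at most one variable and each variable is read in at most one layer.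
   Formalization: π-intervals are read as full contiguous blocks (singletons and the empty block allowed), programs have no parallel edges, and O(S²) is claimed for layerings whose edges may skip layers; with edges only between consecutive layers the size bound is just polynomial in S. *)

theory Defs
  imports "HOL-Library.Poly_Mapping" "HOL-Combinatorics.Permutations"
begin

text \<open>Polynomials in the variables \<open>x\<^sub>i\<close> (\<open>i :: nat\<close>): finitely supported
  functions from monomials (exponent vectors) to coefficients. A polynomial over
  \<open>X = {x\<^sub>1, \<dots>, x\<^sub>n}\<close> uses the indices \<open>{1..n}\<close> only.\<close>

type_synonym 'a mpoly = "(nat \<Rightarrow>\<^sub>0 nat) \<Rightarrow>\<^sub>0 'a"

datatype 'a label = Var nat | Const 'a

fun label_poly :: "'a::comm_ring_1 label \<Rightarrow> 'a mpoly" where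
  "label_poly (Var i) = Poly_Mapping.single (Poly_Mapping.single i 1) 1"
| "label_poly (Const c) = Poly_Mapping.single 0 c"

text \<open>\<open>edge P u v\<close> is \<open>None\<close> if there is no edge from \<open>u\<close> to \<open>v\<close>; in
  particular there are no parallel edges.\<close>

record 'a abp =
  nodes :: "nat set"
  layer :: "nat \<Rightarrow> nat"
  edge :: "nat \<Rightarrow> nat \<Rightarrow> 'a label option"
  source :: nat
  sink :: nat

text \<open>Edges lead from a layer to some later layer, not necessarily the next one. Programs all
  of whose edges join consecutive layers are singled out by \<open>adjacent_layers\<close>. The number of
  nodes depends on this choice (though only polynomially), since skipping edges need no
  intermediate nodes.\<close>

definition is_abp :: "nat \<Rightarrow> 'a abp \<Rightarrow> bool" where
  "is_abp n P \<longleftrightarrow>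
     finite (nodes P) \<and> source P \<in> nodes P \<and> sink P \<in> nodes P \<and>
     (\<forall>v\<in>nodes P. v \<noteq> source P \<longrightarrow> layer P (source P) < layer P v) \<and>
     (\<forall>v\<in>nodes P. v \<noteq> sink P \<longrightarrow> layer P v < layer P (sink P)) \<and>
     (\<forall>u v. edge P u v \<noteq> None \<longrightarrow> u \<in> nodes P \<and> v \<in> nodes P \<and> layer P u < layer P v) \<and>
     (\<forall>u v i. edge P u v = Some (Var i) \<longrightarrow> i \<in> {1..n})"

definition adjacent_layers :: "'a abp \<Rightarrow> bool" where
  "adjacent_layers P \<longleftrightarrow> (\<forall>u v. edge P u v \<noteq> None \<longrightarrow> layer P v = Suc (layer P u))"

definition abp_size :: "'a abp \<Rightarrow> nat" where
  "abp_size P = card (nodes P)"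

definition paths :: "'a abp \<Rightarrow> nat \<Rightarrow> nat \<Rightarrow> nat list set" where
  "paths P u v = {p. p \<noteq> [] \<and> hd p = u \<and> last p = v \<and> set p \<subseteq> nodes P \<and>
                     successively (\<lambda>a b. edge P a b \<noteq> None) p}"

definition path_labels :: "'a abp \<Rightarrow> nat list \<Rightarrow> 'a label list" where
  "path_labels P p = map (\<lambda>(a, b). the (edge P a b)) (zip p (tl p))"

definition abp_poly :: "'a::comm_ring_1 abp \<Rightarrow> 'a mpoly" where
  "abp_poly P = (\<Sum>p\<in>paths P (source P) (sink P). prod_list (map label_poly (path_labels P p)))"

text \<open>The sub-program \<open>[u,v]\<^sub>P\<close>: everything lying on a path from \<open>u\<close> to \<open>v\<close>. An edge of \<open>P\<close>
  joining two nodes on such paths itself lies on such a path.\<close>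

definition subprogram :: "'a abp \<Rightarrow> nat \<Rightarrow> nat \<Rightarrow> 'a abp" where
  "subprogram P u v =
     (let N = (\<Union>p\<in>paths P u v. set p) in
      \<lparr> nodes = N, layer = layer P,
        edge = (\<lambda>a b. if a \<in> N \<and> b \<in> N then edge P a b else None),
        source = u, sink = v \<rparr>)"

definition abp_vars :: "'a abp \<Rightarrow> nat set" where
  "abp_vars P = {i. \<exists>a b. edge P a b = Some (Var i)}"

definition syntactic_multilinear :: "'a abp \<Rightarrow> bool" where
  "syntactic_multilinear P \<longleftrightarrow>
     (\<forall>p\<in>paths P (source P) (sink P). \<forall>i. count_list (path_labels P p) (Var i) \<le> 1)"

text \<open>A \<open>\<pi>\<close>-interval is a contiguous block \<open>{x\<^bsub>\<pi>(i)\<^esub>, \<dots>, x\<^bsub>\<pi>(j)\<^esub>}\<close>. Singletons (\<open>i = j\<close>) and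
  the empty block (\<open>j < i\<close>) are included: sub-programs may read one variable or none, and the
  intervals of consecutive sub-programs have to be disjoint.\<close>

definition is_pi_interval :: "nat \<Rightarrow> (nat \<Rightarrow> nat) \<Rightarrow> nat set \<Rightarrow> bool" where
  "is_pi_interval n \<pi> I \<longleftrightarrow> (\<exists>i j. 1 \<le> i \<and> j \<le> n \<and> I = \<pi> ` {i..j})"

definition strict_interval_abp :: "nat \<Rightarrow> 'a abp \<Rightarrow> (nat \<Rightarrow> nat) \<Rightarrow> bool" where
  "strict_interval_abp n P \<pi> \<longleftrightarrow>
     is_abp n P \<and> syntactic_multilinear P \<and> \<pi> permutes {1..n} \<and>
     (\<exists>I. (\<forall>u\<in>nodes P. \<forall>v\<in>nodes P.
             is_pi_interval n \<pi> (I u v) \<and> abp_vars (subprogram P u v) \<subseteq> I u v) \<and>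
          (\<forall>u\<in>nodes P. \<forall>v\<in>nodes P. \<forall>w\<in>nodes P. I u v \<inter> I v w = {}))"

text \<open>A variable is read in layer \<open>l\<close> if it labels an edge leaving layer \<open>l\<close>.\<close>

definition reads_in_layer :: "'a abp \<Rightarrow> nat \<Rightarrow> nat \<Rightarrow> bool" where
  "reads_in_layer P l i \<longleftrightarrow> (\<exists>a b. layer P a = l \<and> edge P a b = Some (Var i))"

definition is_roabp :: "nat \<Rightarrow> 'a abp \<Rightarrow> bool" where
  "is_roabp n P \<longleftrightarrow>
     is_abp n P \<and> syntactic_multilinear P \<and>
     (\<forall>l i j. reads_in_layer P l i \<and> reads_in_layer P l j \<longrightarrow> i = j) \<and>
     (\<forall>l m i. reads_in_layer P l i \<and> reads_in_layer P m i \<longrightarrow> l = m)"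

end

(* Disjointness of the intervals of consecutive sub-programs forces every source-sink path of a
   strict-interval program to read its variables in increasing or in decreasing order of rank.
   More precisely, at each node v on such a path all variables before v precede all variables
   after v ("up"), or conversely ("down"); both hold where one of the two sets is empty. A path
   either has only up nodes, or it contains a node that is not up and then has only down nodes.
   Reversing the edges turns the paths of the second kind into increasing ones, so a copy for
   each kind yields one program that reads all variables in the same order. Such a program
   becomes a ROABP by subdividing the edges that read variables. Conversely, a ROABP is a
   strict-interval program for the order in which its layers read the variables. *)

theory Submission
  imports Defs "HOL-Library.Countable"
begin

text \<open>Up and down parts cannot mix on a path: if \<open>w\<close> comes before
  \<open>w'\<close>, then a variable before \<open>w\<close> and one after \<open>w'\<close> are
  compared at both nodes, so the two comparisons must agree. The obstacle is that a node with
  nothing before it or nothing after it is both up and down, so a path can fit both copies and would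
  be counted twice. This has to be excluded by conditions on single edges, since a program cannot
  look at whole paths. The reversed copy therefore loses the edges that lead from a node with
  nothing before it to one with something before and nothing after it, and it is dropped if no
  variable lies before the sink. Different programs are not compared by matching their paths. Path
  sums are the only solution of a recursion along the edges, and each construction is verified by
  naming a solution. The same recursion, read from the other end, shows that reversing edges does
  not change a polynomial, because edge labels commute.\<close>

section \<open>Path sums\<close>

text \<open>A missing edge weighs 0, so that sums over neighbours can range over all nodes.\<close>

definition weight :: "'a::comm_ring_1 label option \<Rightarrow> 'a mpoly" where
  "weight e = (case e of None \<Rightarrow> 0 | Some l \<Rightarrow> label_poly l)"

lemma weight_simps [simp]: "weight None = 0" "weight (Some l) = label_poly l"
  by (simp_all add: weight_def)

definition path_sum :: "'a::comm_ring_1 abp \<Rightarrow> nat \<Rightarrow> nat \<Rightarrow> 'a mpoly" where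
  "path_sum P u v = (\<Sum>p\<in>paths P u v. prod_list (map label_poly (path_labels P p)))"

definition dag :: "'a abp \<Rightarrow> bool" where
  "dag P \<longleftrightarrow> finite (nodes P) \<and>
     (\<forall>u v. edge P u v \<noteq> None \<longrightarrow> u \<in> nodes P \<and> v \<in> nodes P \<and> layer P u < layer P v)"

lemma is_abp_dag: "is_abp n P \<Longrightarrow> dag P"
  by (auto simp: is_abp_def dag_def)

lemma dag_edgeD:
  assumes "dag P" "edge P u v = Some l"
  shows "u \<in> nodes P" "v \<in> nodes P" "layer P u < layer P v"
  using assms by (auto simp: dag_def)

text \<open>Layers increase strictly along a path, so no node repeats.\<close>

lemma finite_paths:
  assumes "dag P"
  shows "finite (paths P u v)"
proof (rule finite_subset)
  show "paths P u v \<subseteq> {p. set p \<subseteq> nodes P \<and> distinct p}"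
  proof
    fix p assume p: "p \<in> paths P u v"
    have "successively (\<lambda>a b. layer P a < layer P b) p"
      using p assms unfolding paths_def dag_def
      by (auto elim!: successively_mono)
    then have "sorted_wrt (\<lambda>a b. layer P a < layer P b) p"
      by (subst (asm) successively_iff_sorted_wrt_strong) auto
    then have "distinct p"
      by (induction p) auto
    then show "p \<in> {p. set p \<subseteq> nodes P \<and> distinct p}"
      using p by (auto simp: paths_def)
  qed
  show "finite {p. set p \<subseteq> nodes P \<and> distinct p}"
    using assms by (auto simp: dag_def intro: finite_subset_distinct)
qed

lemma paths_Cons_iff:
  "a # p \<in> paths P u v \<longleftrightarrow> a = u \<and> u \<in> nodes P \<and>
     (p = [] \<and> u = v \<or> (\<exists>w. edge P u w \<noteq> None \<and> p \<in> paths P w v))"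
  by (cases p) (auto simp: paths_def)

lemma Nil_not_in_paths [simp]: "[] \<notin> paths P u v"
  by (simp add: paths_def)

lemma paths_unfold:
  assumes "dag P" "u \<in> nodes P"
  shows "paths P u v = (if u = v then {[u]} else {}) \<union>
           (\<Union>w\<in>{w\<in>nodes P. edge P u w \<noteq> None}. (#) u ` paths P w v)"
proof (rule set_eqI)
  fix p
  show "p \<in> paths P u v \<longleftrightarrow> p \<in> (if u = v then {[u]} else {}) \<union>
           (\<Union>w\<in>{w\<in>nodes P. edge P u w \<noteq> None}. (#) u ` paths P w v)"
    using assms by (cases p) (auto simp: paths_Cons_iff dest: dag_edgeD)
qed

lemma path_labels_Cons:
  assumes "p \<in> paths P w v"
  shows "path_labels P (u # p) = the (edge P u w) # path_labels P p"
  using assms by (cases p) (auto simp: path_labels_def paths_def)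

lemma path_sum_forward:
  fixes P :: "'a::comm_ring_1 abp"
  assumes "dag P" "u \<in> nodes P"
  shows "path_sum P u v =
    (if u = v then 1 else 0) + (\<Sum>w\<in>nodes P. weight (edge P u w) * path_sum P w v)"
proof -
  let ?f = "\<lambda>p. prod_list (map label_poly (path_labels P p))"
  let ?W = "{w\<in>nodes P. edge P u w \<noteq> None}"
  have fin: "finite (nodes P)"
    using assms by (simp add: dag_def)
  have "path_sum P u v = sum ?f (if u = v then {[u]} else {}) +
      sum ?f (\<Union>w\<in>?W. (#) u ` paths P w v)"
    unfolding path_sum_def paths_unfold[OF assms]
    using fin finite_paths[OF assms(1)] by (intro sum.union_disjoint) auto
  also have "sum ?f (if u = v then {[u]} else {}) = (if u = v then 1 else 0)"
    by (simp add: path_labels_def)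
  also have "sum ?f (\<Union>w\<in>?W. (#) u ` paths P w v) = (\<Sum>w\<in>?W. sum ?f ((#) u ` paths P w v))"
    using fin finite_paths[OF assms(1)]
    by (intro sum.UNION_disjoint) (auto simp: paths_def)
  also have "\<dots> = (\<Sum>w\<in>?W. weight (edge P u w) * path_sum P w v)"
  proof (rule sum.cong)
    fix w assume "w \<in> ?W"
    then obtain l where l: "edge P u w = Some l"
      by auto
    have "sum ?f ((#) u ` paths P w v) = (\<Sum>p\<in>paths P w v. ?f (u # p))"
      by (simp add: sum.reindex)
    also have "\<dots> = (\<Sum>p\<in>paths P w v. label_poly l * ?f p)"
      by (rule sum.cong) (auto simp: path_labels_Cons l)
    finally show "sum ?f ((#) u ` paths P w v) = weight (edge P u w) * path_sum P w v"
      by (simp add: l path_sum_def sum_distrib_left)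
  qed simp
  also have "\<dots> = (\<Sum>w\<in>nodes P. weight (edge P u w) * path_sum P w v)"
    using fin by (intro sum.mono_neutral_left) auto
  finally show ?thesis .
qed

lemma dag_induct [consumes 2, case_names step]:
  assumes "dag P" "u \<in> nodes P"
    and "\<And>u. u \<in> nodes P \<Longrightarrow> (\<And>w. w \<in> nodes P \<Longrightarrow> edge P u w \<noteq> None \<Longrightarrow> Q w) \<Longrightarrow> Q u"
  shows "Q u"
proof -
  define M where "M = Max (layer P ` nodes P)"
  have M: "layer P v \<le> M" if "v \<in> nodes P" for v
    using that assms(1) by (auto simp: M_def dag_def)
  show ?thesis
    using assms(2)
  proof (induction "M - layer P u" arbitrary: u rule: less_induct)
    case less
    show ?case
    proof (rule assms(3)[OF less.prems])
      fix w assume w: "w \<in> nodes P" "edge P u w \<noteq> None"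
      then have "layer P u < layer P w"
        using assms(1) by (auto simp: dag_def)
      with M[OF w(1)] show "Q w"
        by (intro less.hyps w) linarith
    qed
  qed
qed

text \<open>The value at \<open>u\<close> depends only on values in later layers, hence a single
  solution. The polynomials of all constructed programs are found by this lemma.\<close>

lemma path_sum_unique:
  fixes P :: "'a::comm_ring_1 abp"
  assumes "dag P" "u \<in> nodes P"
    and f: "\<And>u. u \<in> nodes P \<Longrightarrow>
      f u = (if u = v then 1 else 0) + (\<Sum>w\<in>nodes P. weight (edge P u w) * f w)"
  shows "path_sum P u v = f u"
  using assms(1,2)
proof (induction rule: dag_induct)
  case (step u)
  have "(\<Sum>w\<in>nodes P. weight (edge P u w) * path_sum P w v) =
      (\<Sum>w\<in>nodes P. weight (edge P u w) * f w)"
    by (rule sum.cong) (use step.IH in \<open>auto simp: weight_def split: option.split\<close>)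
  then show ?case
    using path_sum_forward[OF assms(1) step.hyps] f[OF step.hyps] by simp
qed

text \<open>As a function of \<open>u\<close>, the right-hand side solves the forward recursion, so
  uniqueness applies and no path has to be cut at its last edge. Writing the weight of the last edge
  in front uses commutativity.\<close>

lemma path_sum_backward:
  fixes P :: "'a::comm_ring_1 abp"
  assumes "dag P" "u \<in> nodes P" "v \<in> nodes P"
  shows "path_sum P u v =
    (if u = v then 1 else 0) + (\<Sum>w\<in>nodes P. weight (edge P w v) * path_sum P u w)"
  using assms(1,2)
proof (rule path_sum_unique)
  fix u assume u: "u \<in> nodes P"
  let ?W = "\<lambda>u w. weight (edge P u w)" and ?d = "\<lambda>u w. if u = w then 1 else 0 :: 'a mpoly"
  have fin: "finite (nodes P)"
    using assms by (simp add: dag_def)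
  have delta: "(\<Sum>w\<in>nodes P. ?W w v * ?d u w) = ?W u v"
    using fin u by (simp add: if_distrib[of "\<lambda>x. _ * x"] sum.delta' cong: if_cong)
  have delta': "(\<Sum>w\<in>nodes P. ?W u w * ?d w v) = ?W u v"
    using fin assms(3) by (simp add: if_distrib[of "\<lambda>x. _ * x"] sum.delta cong: if_cong)
  have "(\<Sum>w\<in>nodes P. ?W w v * path_sum P u w) =
      (\<Sum>w\<in>nodes P. ?W w v * (?d u w + (\<Sum>x\<in>nodes P. ?W u x * path_sum P x w)))"
    by (rule sum.cong) (use path_sum_forward[OF assms(1) u] in auto)
  also have "\<dots> = ?W u v + (\<Sum>w\<in>nodes P. ?W w v * (\<Sum>x\<in>nodes P. ?W u x * path_sum P x w))"
    by (simp only: distrib_left sum.distrib delta)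
  also have "(\<Sum>w\<in>nodes P. ?W w v * (\<Sum>x\<in>nodes P. ?W u x * path_sum P x w)) =
      (\<Sum>w\<in>nodes P. \<Sum>x\<in>nodes P. ?W u x * (?W w v * path_sum P x w))"
    by (simp add: sum_distrib_left mult_ac)
  also have "\<dots> = (\<Sum>x\<in>nodes P. ?W u x * (\<Sum>w\<in>nodes P. ?W w v * path_sum P x w))"
    by (subst sum.swap) (simp add: sum_distrib_left)
  also have "?W u v + \<dots> =
      (\<Sum>w\<in>nodes P. ?W u w * (?d w v + (\<Sum>x\<in>nodes P. ?W x v * path_sum P w x)))"
    by (simp only: distrib_left sum.distrib delta')
  finally show "?d u v + (\<Sum>w\<in>nodes P. ?W w v * path_sum P u w) = ?d u v +
      (\<Sum>w\<in>nodes P. ?W u w * (?d w v + (\<Sum>x\<in>nodes P. ?W x v * path_sum P w x)))"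
    by simp
qed

lemma abp_poly_eq_path_sum: "abp_poly P = path_sum P (source P) (sink P)"
  by (simp add: abp_poly_def path_sum_def)

section \<open>Programs with nodes of an arbitrary countable type\<close>

text \<open>\<open>from_nat\<close> also decodes numbers that are not codes of nodes; the guard in
  \<open>edge\<close> keeps these from carrying edges.\<close>

definition mk_abp :: "'b::countable set \<Rightarrow> ('b \<Rightarrow> nat) \<Rightarrow> ('b \<Rightarrow> 'b \<Rightarrow> 'a label option)
    \<Rightarrow> 'b \<Rightarrow> 'b \<Rightarrow> 'a abp" where
  "mk_abp V lay E s t =
     \<lparr> nodes = to_nat ` V, layer = (\<lambda>a. lay (from_nat a)),
       edge = (\<lambda>a b. if a \<in> to_nat ` V \<and> b \<in> to_nat ` V then E (from_nat a) (from_nat b) else None),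
       source = to_nat s, sink = to_nat t \<rparr>"

lemma mk_abp_simps [simp]:
  "nodes (mk_abp V lay E s t) = to_nat ` V"
  "layer (mk_abp V lay E s t) (to_nat x) = lay x"
  "source (mk_abp V lay E s t) = to_nat s"
  "sink (mk_abp V lay E s t) = to_nat t"
  "x \<in> V \<Longrightarrow> y \<in> V \<Longrightarrow> edge (mk_abp V lay E s t) (to_nat x) (to_nat y) = E x y"
  by (auto simp: mk_abp_def)

lemma edge_mk_abpE:
  assumes "edge (mk_abp V lay E s t) a b = Some l"
  obtains x y where "x \<in> V" "y \<in> V" "a = to_nat x" "b = to_nat y" "E x y = Some l"
  using assms by (auto simp: mk_abp_def split: if_splits)

lemma is_abp_mk_abp:
  assumes "finite V" "s \<in> V" "t \<in> V"
    and "\<And>v. v \<in> V \<Longrightarrow> v \<noteq> s \<Longrightarrow> lay s < lay v"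
    and "\<And>v. v \<in> V \<Longrightarrow> v \<noteq> t \<Longrightarrow> lay v < lay t"
    and "\<And>u v l. u \<in> V \<Longrightarrow> v \<in> V \<Longrightarrow> E u v = Some l \<Longrightarrow> lay u < lay v"
    and "\<And>u v i. u \<in> V \<Longrightarrow> v \<in> V \<Longrightarrow> E u v = Some (Var i) \<Longrightarrow> i \<in> {1..n}"
  shows "is_abp n (mk_abp V lay E s t)"
  using assms unfolding is_abp_def
  by (auto elim!: edge_mk_abpE)

text \<open>Here \<open>f x\<close> is a guess for the path sum from \<open>x\<close> to
  \<open>t\<close>, confirmed by the recursion.\<close>

lemma abp_poly_mk_abp:
  fixes E :: "'b::countable \<Rightarrow> 'b \<Rightarrow> 'a::comm_ring_1 label option"
  assumes abp: "is_abp n (mk_abp V lay E s t)"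
    and f: "\<And>x. x \<in> V \<Longrightarrow> f x = (if x = t then 1 else 0) + (\<Sum>y\<in>V. weight (E x y) * f y)"
  shows "abp_poly (mk_abp V lay E s t) = f s"
proof -
  let ?P = "mk_abp V lay E s t"
  have "path_sum ?P (source ?P) (sink ?P) = (\<lambda>a. f (from_nat a)) (source ?P)"
  proof (rule path_sum_unique[OF is_abp_dag[OF abp]])
    show "source ?P \<in> nodes ?P"
      using abp by (simp add: is_abp_def)
    fix a assume "a \<in> nodes ?P"
    then obtain x where x: "x \<in> V" "a = to_nat x"
      by auto
    then show "f (from_nat a) = (if a = sink ?P then 1 else 0) +
        (\<Sum>b\<in>nodes ?P. weight (edge ?P a b) * f (from_nat b))"
      using f[OF x(1)] by (simp add: sum.reindex)
  qed
  then show ?thesis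
    by (simp add: abp_poly_eq_path_sum)
qed

lemma reads_in_layer_mk_abpE:
  assumes "reads_in_layer (mk_abp V lay E s t) l i"
  obtains x y where "x \<in> V" "y \<in> V" "E x y = Some (Var i)" "lay x = l"
  using assms by (auto simp: reads_in_layer_def elim!: edge_mk_abpE)

section \<open>Reading each variable in a single layer\<close>

lemma reads_in_layerI: "edge P a b = Some (Var i) \<Longrightarrow> reads_in_layer P (layer P a) i"
  by (auto simp: reads_in_layer_def)

lemma reads_in_path:
  assumes "dag P" "p \<in> paths P u v" "Var i \<in> set (path_labels P p)"
  shows "\<exists>l\<ge>layer P u. reads_in_layer P l i"
  using assms(2,3)
proof (induction p arbitrary: u)
  case (Cons a p)
  then have a: "a = u" by (auto simp: paths_Cons_iff)
  show ?case
  proof (cases "p = []")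
    case True
    then show ?thesis using Cons.prems by (simp add: path_labels_def)
  next
    case False
    with Cons.prems obtain w where w: "edge P u w \<noteq> None" "p \<in> paths P w v"
      by (auto simp: paths_Cons_iff)
    then have lt: "layer P u < layer P w"
      using assms(1) by (auto simp: dag_def)
    have "the (edge P u w) = Var i \<or> Var i \<in> set (path_labels P p)"
      using Cons.prems(2) w(2) a by (auto simp: path_labels_Cons)
    then show ?thesis
    proof
      assume "the (edge P u w) = Var i"
      with w(1) show ?thesis
        by (metis reads_in_layerI option.collapse order_refl)
    next
      assume "Var i \<in> set (path_labels P p)"
      from Cons.IH[OF w(2) this] lt show ?thesis
        by (meson less_imp_le order_trans)
    qed
  qed
qed simp

text \<open>A second reading of a variable on the same path would take place in a strictly later
  layer.\<close>

lemma syntactic_multilinearI: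
  assumes "dag P" and *: "\<And>l m i. reads_in_layer P l i \<Longrightarrow> reads_in_layer P m i \<Longrightarrow> l = m"
  shows "syntactic_multilinear P"
proof -
  have "count_list (path_labels P p) (Var i) \<le> 1" if "p \<in> paths P u v" for p u v i
    using that
  proof (induction p arbitrary: u)
    case (Cons a p)
    then have a: "a = u" by (auto simp: paths_Cons_iff)
    show ?case
    proof (cases "p = []")
      case True
      then show ?thesis by (simp add: path_labels_def)
    next
      case False
      with Cons.prems obtain w where w: "edge P u w \<noteq> None" "p \<in> paths P w v"
        by (auto simp: paths_Cons_iff)
      then have lt: "layer P u < layer P w"
        using assms(1) by (auto simp: dag_def)
      have "Var i \<notin> set (path_labels P p)" if "the (edge P u w) = Var i"
      proof
        assume "Var i \<in> set (path_labels P p)"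
        from reads_in_path[OF assms(1) w(2) this]
        obtain l where "l \<ge> layer P w" "reads_in_layer P l i"
          by blast
        moreover have "reads_in_layer P (layer P u) i"
          using that w(1) by (metis reads_in_layerI option.collapse)
        ultimately show False
          using *[of l i "layer P u"] lt by simp
      qed
      then show ?thesis
        using Cons.IH[OF w(2)] a by (simp add: path_labels_Cons[OF w(2)] count_list_0_iff)
    qed
  qed simp
  then show ?thesis
    by (auto simp: syntactic_multilinear_def)
qed

lemma is_roabpI:
  assumes "is_abp n P"
    and "\<And>l i j. reads_in_layer P l i \<Longrightarrow> reads_in_layer P l j \<Longrightarrow> i = j"
    and "\<And>l m i. reads_in_layer P l i \<Longrightarrow> reads_in_layer P m i \<Longrightarrow> l = m"
  shows "is_roabp n P"
  using assms syntactic_multilinearI[OF is_abp_dag[OF assms(1)]] unfolding is_roabp_def by blast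

section \<open>Adjacent layers\<close>

text \<open>After renumbering the layers consecutively, a node \<open>v\<close> is preceded by a chain of copies
  \<open>(v, k)\<close>, one in each earlier layer \<open>k\<close>. A skipping edge reads its label at once and then
  waits in this chain, so every variable stays in its layer.\<close>

lemma roabp_adjacent:
  fixes P :: "'a::comm_ring_1 abp"
  assumes P: "is_roabp n P"
  shows "\<exists>Q :: 'a abp. is_roabp n Q \<and> adjacent_layers Q \<and> abp_poly Q = abp_poly P \<and>
           abp_size Q \<le> abp_size P ^ 2"
proof -
  define N L where "N = nodes P" and "L = layer P"
  define s t where "s = source P" and "t = sink P"
  have abp: "is_abp n P" and dag: "dag P"
    using P is_abp_dag by (auto simp: is_roabp_def)
  have fin: "finite N" and sN: "s \<in> N" and tN: "t \<in> N"
    and sL: "\<And>v. v \<in> N \<Longrightarrow> v \<noteq> s \<Longrightarrow> L s < L v"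
    and tL: "\<And>v. v \<in> N \<Longrightarrow> v \<noteq> t \<Longrightarrow> L v < L t"
    and eVar: "\<And>u v i. edge P u v = Some (Var i) \<Longrightarrow> i \<in> {1..n}"
    using abp by (auto simp: is_abp_def N_def L_def s_def t_def)
  have eN: "u \<in> N \<and> v \<in> N \<and> L u < L v" if "edge P u v = Some l" for u v l
    using dag_edgeD[OF dag that] by (simp add: N_def L_def)
  have read1: "i = j" if "edge P u v = Some (Var i)" "edge P u' v' = Some (Var j)" "L u = L u'"
    for u v u' v' i j
    using P that unfolding is_roabp_def L_def by (metis reads_in_layerI)
  have read2: "L u = L u'" if "edge P u v = Some (Var i)" "edge P u' v' = Some (Var i)"
    for u v u' v' i
    using P that unfolding is_roabp_def L_def by (metis reads_in_layerI)
  \<comment> \<open>The rank of the layer of \<open>v\<close> among the occupied layers. Unlike the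
    layer number it is below \<open>card N\<close>, which bounds the lengths of the chains.\<close>
  define r where "r v = card (L ` N \<inter> {..<L v})" for v
  have r_less: "r u < r v" if "u \<in> N" "L u < L v" for u v
    unfolding r_def using that fin by (intro psubset_card_mono) auto
  have r_eq: "L u = L v" if "u \<in> N" "v \<in> N" "r u = r v" for u v
    using r_less[of u v] r_less[of v u] that by (metis linorder_neq_iff)
  have r_cong: "r u = r v" if "L u = L v" for u v
    using that by (simp add: r_def)
  have r_bound: "r v < card N" if "v \<in> N" for v
  proof -
    have "r v < card (L ` N)"
      unfolding r_def using that fin by (intro psubset_card_mono) auto
    also have "\<dots> \<le> card N"
      using fin by (rule card_image_le)
    finally show ?thesis .
  qed
  have "L ` N \<inter> {..<L s} = {}"
    using sL by (force simp: not_less)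
  then have r_s: "r s = 0"
    by (simp add: r_def)
  \<comment> \<open>Edges out of \<open>u\<close> enter a chain at \<open>r u + 1\<close>, so a copy
    in layer 0 is wanted only for the source, which has to be alone in the first layer.\<close>
  define V where "V = {(v, k). v \<in> N \<and> k \<le> r v \<and> (v = s \<or> 0 < k)}"
  define E :: "nat \<times> nat \<Rightarrow> nat \<times> nat \<Rightarrow> 'a label option" where
    "E = (\<lambda>(u, k) (v, k'). if k' \<noteq> Suc k then None else if k = r u then edge P u v
           else if u = v then Some (Const 1) else None)"
  define Q where "Q = mk_abp V snd E (s, 0) (t, r t)"
  have V_sub: "V \<subseteq> N \<times> {..<card N}"
    using r_bound by (fastforce simp: V_def)
  have finV: "finite V"
    using V_sub fin by (rule finite_subset[OF _ finite_cartesian_product]) auto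
  have absQ: "is_abp n Q"
    unfolding Q_def
  proof (rule is_abp_mk_abp)
    show "(s, 0) \<in> V" "(t, r t) \<in> V"
      using sN tN r_less[OF sN, of t] sL[OF tN] r_s by (cases "t = s"; auto simp: V_def)+
    show "snd (s, 0) < snd v" if "v \<in> V" "v \<noteq> (s, 0)" for v
      using that by (auto simp: V_def r_s)
    show "snd v < snd (t, r t)" if v: "v \<in> V" "v \<noteq> (t, r t)" for v
    proof (cases "fst v = t")
      case True
      then show ?thesis using v by (cases v) (auto simp: V_def)
    next
      case False
      then have "r (fst v) < r t"
        using v tL r_less by (auto simp: V_def)
      then show ?thesis using v by (auto simp: V_def)
    qed
    show "i \<in> {1..n}" if "E u v = Some (Var i)" for u v i
      using that eVar by (auto simp: E_def split: prod.splits if_splits)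
    show "snd u < snd v" if "E u v = Some l" for u v l
      using that by (auto simp: E_def split: prod.splits if_splits)
  qed (rule finV)
  have "abp_poly Q = path_sum P (fst (s, 0::nat)) t"
    unfolding Q_def
  \<comment> \<open>Waiting multiplies by 1, so all copies of a node share its path sum.\<close>
  proof (rule abp_poly_mk_abp[OF absQ[unfolded Q_def], where f = "\<lambda>x. path_sum P (fst x) t"])
    fix x assume x: "x \<in> V"
    obtain u k where xu: "x = (u, k)" by (cases x)
    have uN: "u \<in> N" and ku: "k \<le> r u"
      using x by (auto simp: V_def xu)
    show "path_sum P (fst x) t = (if x = (t, r t) then 1 else 0) +
        (\<Sum>y\<in>V. weight (E x y) * path_sum P (fst y) t)"
    proof (cases "k = r u")
      case True
      have "(\<Sum>y\<in>V. weight (E x y) * path_sum P (fst y) t) =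
          (\<Sum>y\<in>(\<lambda>w. (w, Suc k)) ` N. weight (E x y) * path_sum P (fst y) t)"
      proof (rule sum.mono_neutral_cong)
        show "weight (E x y) * path_sum P (fst y) t = 0" if "y \<in> V - (\<lambda>w. (w, Suc k)) ` N" for y
          using that by (auto simp: E_def xu V_def)
        show "weight (E x y) * path_sum P (fst y) t = 0" if y: "y \<in> (\<lambda>w. (w, Suc k)) ` N - V" for y
        proof -
          obtain w where w: "w \<in> N" "y = (w, Suc k)" using y by auto
          have "edge P u w = None"
          proof (rule ccontr)
            assume "edge P u w \<noteq> None"
            then have "r u < r w" using eN r_less by blast
            then show False using y w True by (auto simp: V_def)
          qed
          then show ?thesis by (simp add: E_def xu w True)
        qed
      qed (use finV fin in auto)
      also have "\<dots> = (\<Sum>w\<in>N. weight (edge P u w) * path_sum P w t)"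
        by (subst sum.reindex) (auto simp: inj_on_def E_def xu True)
      finally show ?thesis
        using path_sum_forward[OF dag, of u t] uN True by (auto simp: xu N_def)
    next
      case False
      then have y: "(u, Suc k) \<in> V"
        using ku uN by (simp add: V_def)
      have "(\<Sum>y\<in>V. weight (E x y) * path_sum P (fst y) t) =
          (\<Sum>y\<in>V. if y = (u, Suc k) then path_sum P u t else 0)"
        by (rule sum.cong) (use False in \<open>auto simp: E_def xu single_one split: if_splits\<close>)
      then show ?thesis
        using y finV False by (auto simp: xu)
    qed
  qed
  then have poly: "abp_poly Q = abp_poly P"
    by (simp add: abp_poly_eq_path_sum s_def t_def)
  have reads: "\<exists>u v. edge P u v = Some (Var i) \<and> u \<in> N \<and> r u = l" if rd: "reads_in_layer Q l i" for l i
    using rd unfolding Q_def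
    by (rule reads_in_layer_mk_abpE) (auto simp: E_def dest: eN split: prod.splits if_splits)
  have "is_roabp n Q"
  proof (rule is_roabpI[OF absQ])
    show "i = j" if "reads_in_layer Q l i" "reads_in_layer Q l j" for l i j
      using reads[OF that(1)] reads[OF that(2)] read1 r_eq by metis
    show "l = m" if "reads_in_layer Q l i" "reads_in_layer Q m i" for l m i
      using reads[OF that(1)] reads[OF that(2)] read2 r_cong by metis
  qed
  moreover have "adjacent_layers Q"
    unfolding adjacent_layers_def Q_def
    by (auto elim!: edge_mk_abpE simp: E_def split: if_splits)
  moreover have "abp_size Q \<le> abp_size P ^ 2"
  proof -
    have "card V \<le> card (N \<times> {..<card N})"
      using V_sub fin by (intro card_mono) auto
    then show ?thesis
      by (simp add: Q_def abp_size_def N_def card_image card_cartesian_product power2_eq_square)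
  qed
  ultimately show ?thesis
    using poly by blast
qed

section \<open>Variables of sub-programs\<close>

definition edges :: "'a abp \<Rightarrow> (nat \<times> nat) set" where
  "edges P = {(u, v). edge P u v \<noteq> None}"

lemma edges_iff: "(u, v) \<in> edges P \<longleftrightarrow> (\<exists>l. edge P u v = Some l)"
  by (auto simp: edges_def)

lemma rtrancl_edges_layer_le:
  assumes "dag P" "(u, v) \<in> (edges P)\<^sup>*"
  shows "layer P u \<le> layer P v"
  using assms(2) by induction (use assms(1) in \<open>auto simp: edges_iff dest: dag_edgeD\<close>)

lemma path_rtrancl_edges:
  assumes "p \<in> paths P u v" "a \<in> set p"
  shows "(u, a) \<in> (edges P)\<^sup>* \<and> (a, v) \<in> (edges P)\<^sup>*"
  using assms
proof (induction p arbitrary: u a)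
  case (Cons b p)
  show ?case
  proof (cases "p = []")
    case True
    then show ?thesis using Cons.prems by (auto simp: paths_Cons_iff)
  next
    case False
    with Cons.prems obtain w where w: "(u, w) \<in> edges P" "p \<in> paths P w v"
      by (auto simp: paths_Cons_iff edges_iff)
    have "(u, v) \<in> (edges P)\<^sup>*"
    proof -
      have "last p = v" "p \<noteq> []" using w(2) by (auto simp: paths_def)
      then have "(w, v) \<in> (edges P)\<^sup>*"
        using Cons.IH[OF w(2)] by (metis last_in_set)
      then show ?thesis using w(1) by (rule converse_rtrancl_into_rtrancl[rotated])
    qed
    moreover have "a = u \<or> a \<in> set p"
      using Cons.prems by (auto simp: paths_Cons_iff)
    ultimately show ?thesis
      using Cons.IH[OF w(2), of a] w(1) by (auto intro: converse_rtrancl_into_rtrancl)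
  qed
qed simp

lemma path_through:
  assumes "dag P" "a \<in> nodes P" "(u, a) \<in> (edges P)\<^sup>*" "(a, v) \<in> (edges P)\<^sup>*"
  shows "\<exists>p\<in>paths P u v. a \<in> set p"
  using assms(3)
proof (induction rule: converse_rtrancl_induct)
  case base
  have "a \<in> nodes P \<longrightarrow> (\<exists>p. p \<in> paths P a v)"
    using assms(4)
  proof (induction rule: converse_rtrancl_induct)
    case base
    have "v \<in> nodes P \<Longrightarrow> [v] \<in> paths P v v" by (simp add: paths_def)
    then show ?case by blast
  next
    case (step y z)
    then obtain p where p: "p \<in> paths P z v"
      using assms(1) by (auto simp: edges_iff dest: dag_edgeD)
    then have "y # p \<in> paths P y v"
      using step.hyps(1) assms(1) by (auto simp: paths_Cons_iff edges_iff dest: dag_edgeD)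
    then show ?case by blast
  qed
  then obtain p where "p \<in> paths P a v" using assms(2) by blast
  then show ?case by (intro bexI[of _ p]) (auto simp: paths_def)
next
  case (step y z)
  then obtain p where p: "p \<in> paths P z v" "a \<in> set p"
    by blast
  then have "y # p \<in> paths P y v"
    using step.hyps(1) assms(1) by (auto simp: paths_Cons_iff edges_iff dest: dag_edgeD)
  with p(2) show ?case by (intro bexI[of _ "y # p"]) auto
qed

text \<open>The two ends of an edge of the sub-program may come from different paths, but only
  reachability of \<open>a\<close> from \<open>u\<close> and of \<open>v\<close> from
  \<open>b\<close> matters. In this form, inclusions between the variables of sub-programs follow
  from transitivity.\<close>

lemma abp_vars_subprogram_iff:
  assumes "dag P"
  shows "i \<in> abp_vars (subprogram P u v) \<longleftrightarrow>
    (\<exists>a b. edge P a b = Some (Var i) \<and> (u, a) \<in> (edges P)\<^sup>* \<and> (b, v) \<in> (edges P)\<^sup>*)"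
    (is "?l \<longleftrightarrow> ?r")
proof
  assume ?l
  then obtain a b p q where "edge P a b = Some (Var i)"
      "p \<in> paths P u v" "a \<in> set p" "q \<in> paths P u v" "b \<in> set q"
    unfolding abp_vars_def subprogram_def Let_def by (auto split: if_splits)
  then show ?r
    using path_rtrancl_edges by blast
next
  assume ?r
  then obtain a b where ab: "edge P a b = Some (Var i)"
    "(u, a) \<in> (edges P)\<^sup>*" "(b, v) \<in> (edges P)\<^sup>*"
    by blast
  then have e: "(a, b) \<in> edges P" by (simp add: edges_iff)
  have "\<exists>p\<in>paths P u v. a \<in> set p"
    using path_through[OF assms dag_edgeD(1)[OF assms ab(1)] ab(2)]
      converse_rtrancl_into_rtrancl[OF e ab(3)] by blast
  moreover have "\<exists>p\<in>paths P u v. b \<in> set p"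
    using path_through[OF assms dag_edgeD(2)[OF assms ab(1)] _ ab(3)]
      rtrancl_into_rtrancl[OF ab(2) e] by blast
  ultimately show ?l
    using ab(1) unfolding abp_vars_def subprogram_def Let_def by auto
qed

section \<open>Read-once programs are strict-interval programs\<close>

lemma ex_sorting_permutation:
  fixes \<kappa> :: "nat \<Rightarrow> nat"
  shows "\<exists>\<pi>. \<pi> permutes {1..n} \<and> mono_on {1..n} (\<kappa> \<circ> \<pi>)"
proof -
  define xs where "xs = sort_key \<kappa> [1..<Suc n]"
  define \<pi> where "\<pi> k = (if k \<in> {1..n} then xs ! (k - 1) else k)" for k
  have xs: "length xs = n" "distinct xs" "set xs = {1..n}" "sorted (map \<kappa> xs)"
    by (auto simp: xs_def)
  have "inj_on \<pi> {1..n}"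
    using xs(1,2) by (auto simp: inj_on_def \<pi>_def nth_eq_iff_index_eq)
  moreover have "\<pi> ` {1..n} \<subseteq> {1..n}"
  proof
    fix y assume "y \<in> \<pi> ` {1..n}"
    then obtain k where "k \<in> {1..n}" "y = xs ! (k - 1)" by (auto simp: \<pi>_def)
    then have "y \<in> set xs" using xs(1) by (auto intro!: nth_mem)
    then show "y \<in> {1..n}" using xs(3) by simp
  qed
  ultimately have "bij_betw \<pi> {1..n} {1..n}"
    by (simp add: bij_betw_def endo_inj_surj)
  then have "\<pi> permutes {1..n}"
    by (rule bij_imp_permutes) (unfold \<pi>_def, rule if_not_P)
  moreover have "mono_on {1..n} (\<kappa> \<circ> \<pi>)"
  proof (rule mono_onI)
    fix j k assume "j \<in> {1..n}" "k \<in> {1..n}" "j \<le> k"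
    then show "(\<kappa> \<circ> \<pi>) j \<le> (\<kappa> \<circ> \<pi>) k"
      using sorted_nth_mono[OF xs(4), of "j - 1" "k - 1"] xs(1) by (auto simp: \<pi>_def)
  qed
  ultimately show ?thesis by blast
qed

text \<open>In sorted order, the indices whose keys lie in a window are consecutive. An empty window
  is the block from 1 to 0.\<close>

lemma is_pi_interval_key:
  fixes \<kappa> :: "nat \<Rightarrow> nat"
  assumes "\<pi> permutes {1..n}" "mono_on {1..n} (\<kappa> \<circ> \<pi>)"
  shows "is_pi_interval n \<pi> {i\<in>{1..n}. l \<le> \<kappa> i \<and> \<kappa> i < m}"
proof -
  define K where "K = {k\<in>{1..n}. l \<le> \<kappa> (\<pi> k) \<and> \<kappa> (\<pi> k) < m}"
  have K: "\<pi> ` K = {i\<in>{1..n}. l \<le> \<kappa> i \<and> \<kappa> i < m}"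
  proof -
    have "\<pi> ` K = {i\<in>\<pi> ` {1..n}. l \<le> \<kappa> i \<and> \<kappa> i < m}"
      by (auto simp: K_def)
    then show ?thesis
      by (simp only: permutes_image[OF assms(1)])
  qed
  have fin: "finite K" by (simp add: K_def)
  show ?thesis
  proof (cases "K = {}")
    case True
    then show ?thesis
      unfolding is_pi_interval_def K[symmetric] by (intro exI[of _ 1] exI[of _ 0]) simp
  next
    case False
    have in_K: "Min K \<in> K" "Max K \<in> K"
      using fin False by simp_all
    have "{Min K..Max K} \<subseteq> K"
    proof
      fix k assume k: "k \<in> {Min K..Max K}"
      then have "k \<in> {1..n}" using in_K by (auto simp: K_def)
      moreover have "\<kappa> (\<pi> (Min K)) \<le> \<kappa> (\<pi> k)" "\<kappa> (\<pi> k) \<le> \<kappa> (\<pi> (Max K))"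
        using k in_K \<open>k \<in> {1..n}\<close> assms(2) by (auto simp: K_def monotone_on_def)
      ultimately show "k \<in> K" using in_K by (auto simp: K_def)
    qed
    then have "K = {Min K..Max K}"
      using fin by auto
    then show ?thesis
      unfolding is_pi_interval_def K[symmetric]
      using in_K by (intro exI[of _ "Min K"] exI[of _ "Max K"]) (auto simp: K_def)
  qed
qed

lemma roabp_strict_interval:
  assumes P: "is_roabp n P"
  shows "\<exists>\<pi>. strict_interval_abp n P \<pi>"
proof -
  have abp: "is_abp n P" and dag: "dag P"
    using P is_abp_dag by (auto simp: is_roabp_def)
  \<comment> \<open>The key is the layer in which a variable is read. Variables that are never read
    get the layer of the sink, so that they fall into no window \<open>I u v\<close> between
    nodes.\<close>
  define \<kappa> where "\<kappa> i = (if \<exists>l. reads_in_layer P l i then THE l. reads_in_layer P l i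
      else layer P (sink P))" for i
  have \<kappa>: "\<kappa> i = l" if "reads_in_layer P l i" for i l
  proof -
    have "(THE l. reads_in_layer P l i) = l"
      using that P unfolding is_roabp_def by (intro the_equality) blast+
    then show ?thesis
      using that by (auto simp: \<kappa>_def)
  qed
  obtain \<pi> where \<pi>: "\<pi> permutes {1..n}" "mono_on {1..n} (\<kappa> \<circ> \<pi>)"
    using ex_sorting_permutation by blast
  \<comment> \<open>A variable read on leaving the layer of \<open>v\<close> belongs to the window
    starting at \<open>v\<close>; half-open windows that meet at \<open>v\<close> are thus
    disjoint.\<close>
  define I where "I u v = {i\<in>{1..n}. layer P u \<le> \<kappa> i \<and> \<kappa> i < layer P v}" for u v
  have "abp_vars (subprogram P u v) \<subseteq> I u v" for u v
  proof
    fix i assume "i \<in> abp_vars (subprogram P u v)"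
    then obtain a b where ab: "edge P a b = Some (Var i)"
      "(u, a) \<in> (edges P)\<^sup>*" "(b, v) \<in> (edges P)\<^sup>*"
      using abp_vars_subprogram_iff[OF dag] by blast
    have "\<kappa> i = layer P a"
      using \<kappa> reads_in_layerI[OF ab(1)] by blast
    moreover have "layer P u \<le> layer P a" "layer P a < layer P b" "layer P b \<le> layer P v"
      using rtrancl_edges_layer_le[OF dag] dag_edgeD[OF dag ab(1)] ab by auto
    moreover have "i \<in> {1..n}"
      using abp ab(1) by (auto simp: is_abp_def)
    ultimately show "i \<in> I u v"
      by (simp add: I_def)
  qed
  moreover have "is_pi_interval n \<pi> (I u v)" for u v
    unfolding I_def using \<pi> by (rule is_pi_interval_key)
  moreover have "I u v \<inter> I v w = {}" for u v w
    by (auto simp: I_def)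
  ultimately have "strict_interval_abp n P \<pi>"
    using P \<pi>(1) unfolding strict_interval_abp_def is_roabp_def by blast
  then show ?thesis by blast
qed

section \<open>Programs reading the variables in a fixed order\<close>

text \<open>Stated for a label and two positions rather than for an edge of a program, so that it
  also serves reversed edges, with the positions exchanged.\<close>

definition fits :: "(nat \<Rightarrow> nat) \<Rightarrow> 'a label option \<Rightarrow> nat \<Rightarrow> nat \<Rightarrow> bool" where
  "fits \<rho> e a b \<longleftrightarrow> (e \<noteq> None \<longrightarrow> a \<le> b) \<and> (\<forall>i. e = Some (Var i) \<longrightarrow> a < \<rho> i \<and> \<rho> i \<le> b)"

text \<open>The number \<open>pos v\<close> bounds the ranks of the variables read before the node \<open>v\<close> from above
  and those of the variables read after it strictly from below.\<close>

definition ordered_by :: "(nat \<Rightarrow> nat) \<Rightarrow> (nat \<Rightarrow> nat) \<Rightarrow> 'a abp \<Rightarrow> bool" where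
  "ordered_by \<rho> pos P \<longleftrightarrow> pos (source P) = 0 \<and> (\<forall>v\<in>nodes P. pos v \<le> pos (sink P)) \<and>
     (\<forall>u v. fits \<rho> (edge P u v) (pos u) (pos v))"

fun label_var :: "'a label option \<Rightarrow> nat" where
  "label_var (Some (Var i)) = i"
| "label_var _ = 0"

text \<open>An edge reading a variable is split into a constant 1 followed by the variable. The
  variable is on the second half because the layer in which it is read is the one its edge leaves,
  and the layer of the new node can be chosen by the variable alone.\<close>

fun subdivided_edge :: "'a::one abp \<Rightarrow> nat + nat \<times> nat \<Rightarrow> nat + nat \<times> nat \<Rightarrow> 'a label option" where
  "subdivided_edge P (Inl u) (Inl v) =
     (case edge P u v of Some (Const c) \<Rightarrow> Some (Const c) | _ \<Rightarrow> None)"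
| "subdivided_edge P (Inl u) (Inr (u', v)) = (if u = u' then Some (Const 1) else None)"
| "subdivided_edge P (Inr (u, v)) (Inl v') = (if v = v' then edge P u v else None)"
| "subdivided_edge P (Inr _) (Inr _) = None"

text \<open>The nodes at position \<open>k\<close> are placed in the \<open>k\<close>-th block of layers, in their old order.
  A new node on each edge reading the variable of rank \<open>k\<close> is placed in the first layer of that
  block.\<close>

lemma ordered_abp_to_roabp:
  fixes P :: "'a::comm_ring_1 abp"
  assumes abp: "is_abp n P" and ord: "ordered_by \<rho> pos P" and inj: "inj_on \<rho> {1..n}"
  shows "\<exists>Q :: 'a abp. is_roabp n Q \<and> abp_poly Q = abp_poly P \<and>
           abp_size Q \<le> abp_size P + abp_size P ^ 2"
proof -
  define N L where "N = nodes P" and "L = layer P"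
  define s t where "s = source P" and "t = sink P"
  have dag: "dag P"
    using abp by (rule is_abp_dag)
  have fin: "finite N" and sN: "s \<in> N" and tN: "t \<in> N"
    and sL: "\<And>v. v \<in> N \<Longrightarrow> v \<noteq> s \<Longrightarrow> L s < L v"
    and tL: "\<And>v. v \<in> N \<Longrightarrow> v \<noteq> t \<Longrightarrow> L v < L t"
    and eVar: "\<And>u v i. edge P u v = Some (Var i) \<Longrightarrow> i \<in> {1..n}"
    using abp by (auto simp: is_abp_def N_def L_def s_def t_def)
  have eN: "u \<in> N \<and> v \<in> N \<and> L u < L v" if "edge P u v = Some l" for u v l
    using dag_edgeD[OF dag that] by (simp add: N_def L_def)
  have pos_s: "pos s = 0" and pos_t: "\<And>v. v \<in> N \<Longrightarrow> pos v \<le> pos t"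
    using ord by (auto simp: ordered_by_def N_def s_def t_def)
  have fitsE: "fits \<rho> (edge P u v) (pos u) (pos v)" for u v
    using ord by (simp add: ordered_by_def)
  have pos_edge: "pos u \<le> pos v" if "edge P u v = Some l" for u v l
    using fitsE[of u v] that by (simp add: fits_def)
  have pos_Var: "pos u < \<rho> i" "\<rho> i \<le> pos v" if "edge P u v = Some (Var i)" for u v i
    using fitsE[of u v] that by (auto simp: fits_def)
  have L_le: "L v \<le> L t" if "v \<in> N" for v
    using tL that by (cases "v = t") (auto intro: less_imp_le)
  \<comment> \<open>The length of a block: offset 0 for the new nodes, and offsets
    \<open>1 + L v\<close>, at most \<open>L t + 1\<close>, for the old ones.\<close>
  define M where "M = L t + 2"
  define X where "X = {(u, v). \<exists>i. edge P u v = Some (Var i)}"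
  define V where "V = Inl ` N \<union> Inr ` X"
  define lay :: "nat + nat \<times> nat \<Rightarrow> nat" where
    "lay x = (case x of Inl v \<Rightarrow> pos v * M + 1 + L v | Inr (u, v) \<Rightarrow> \<rho> (label_var (edge P u v)) * M)" for x
  define Q where "Q = mk_abp V lay (subdivided_edge P) (Inl s) (Inl t)"
  have X_sub: "X \<subseteq> N \<times> N"
    using eN by (auto simp: X_def)
  have finX: "finite X"
    using X_sub by (rule finite_subset) (simp add: fin)
  have finV: "finite V"
    using fin finX by (simp add: V_def)
  have lay_less: "lay (Inl u) < \<rho> i * M" if "u \<in> N" "pos u < \<rho> i" for u i
  proof -
    have "Suc (pos u) * M \<le> \<rho> i * M"
      using that(2) by (intro mult_right_mono) auto
    moreover have "1 + L u < M"
      using L_le[OF that(1)] by (simp add: M_def)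
    ultimately show ?thesis by (simp add: lay_def)
  qed
  have less_lay: "\<rho> i * M < lay (Inl v)" if "\<rho> i \<le> pos v" for v i
  proof -
    have "\<rho> i * M \<le> pos v * M"
      using that by (intro mult_right_mono) auto
    then have "\<rho> i * M < pos v * M + 1 + L v"
      by linarith
    then show ?thesis by (simp add: lay_def)
  qed
  have lay_edge: "lay (Inl u) < lay (Inl v)" if "pos u \<le> pos v" "L u < L v" for u v
  proof -
    have "pos u * M \<le> pos v * M"
      using that(1) by (intro mult_right_mono) auto
    then have "pos u * M + 1 + L u < pos v * M + 1 + L v"
      using that(2) by linarith
    then show ?thesis by (simp add: lay_def)
  qed
  have lay_X: "lay (Inl u) < lay (Inr (u, v))" "lay (Inr (u, v)) < lay (Inl v)"
    if "(u, v) \<in> X" for u v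
    using that eN lay_less[of u] less_lay[of _ v] pos_Var[of u v]
    by (auto simp: X_def lay_def)
  have lay_s: "lay (Inl s) < lay (Inl v)" if "v \<in> N" "v \<noteq> s" for v
    using lay_edge[of s v] sL that pos_s by simp
  have lay_t: "lay (Inl v) < lay (Inl t)" if "v \<in> N" "v \<noteq> t" for v
    using lay_edge[of v t] tL that pos_t by simp
  have lay_le_t: "lay (Inl v) \<le> lay (Inl t)" if "v \<in> N" for v
    using lay_t[OF that] by (cases "v = t") auto
  have lay_s_le: "lay (Inl s) \<le> lay (Inl v)" if "v \<in> N" for v
    using lay_s[OF that] by (cases "v = s") auto
  have absQ: "is_abp n Q"
    unfolding Q_def
  proof (rule is_abp_mk_abp)
    show "Inl s \<in> V" "Inl t \<in> V"
      using sN tN by (auto simp: V_def)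
    show "lay (Inl s) < lay x" if "x \<in> V" "x \<noteq> Inl s" for x
      using that lay_s lay_X lay_s_le X_sub
      by (auto simp: V_def) (meson mem_Sigma_iff order_le_less_trans subsetD)
    show "lay x < lay (Inl t)" if "x \<in> V" "x \<noteq> Inl t" for x
      using that lay_t lay_X lay_le_t X_sub
      by (auto simp: V_def) (meson mem_Sigma_iff order_less_le_trans subsetD)
    show "lay x < lay y" if "x \<in> V" "y \<in> V" "subdivided_edge P x y = Some l" for x y l
      using that(3,1,2) lay_edge pos_edge eN lay_X
      by (cases "(P, x, y)" rule: subdivided_edge.cases)
        (auto simp: V_def split: if_splits option.splits label.splits)
    show "i \<in> {1..n}" if "subdivided_edge P x y = Some (Var i)" for x y i
      using that eVar
      by (cases "(P, x, y)" rule: subdivided_edge.cases)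
        (auto split: if_splits option.splits label.splits)
  qed (rule finV)
  define f where "f x = (case x of Inl v \<Rightarrow> path_sum P v t
      | Inr (u, v) \<Rightarrow> weight (edge P u v) * path_sum P v t)" for x
  have sumV: "sum g V = (\<Sum>v\<in>N. g (Inl v)) + (\<Sum>p\<in>X. g (Inr p))"
    for g :: "nat + nat \<times> nat \<Rightarrow> 'a mpoly"
  proof -
    have "sum g V = sum g (Inl ` N) + sum g (Inr ` X)"
      unfolding V_def using fin finX by (intro sum.union_disjoint) auto
    then show ?thesis
      by (simp add: sum.reindex)
  qed
  have "abp_poly Q = f (Inl s)"
    unfolding Q_def
  proof (rule abp_poly_mk_abp[OF absQ[unfolded Q_def]])
    fix x assume x: "x \<in> V"
    show "f x = (if x = Inl t then 1 else 0) + (\<Sum>y\<in>V. weight (subdivided_edge P x y) * f y)"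
    proof (cases x)
      case (Inl u)
      then have u: "u \<in> N" using x by (auto simp: V_def)
      let ?X = "{v\<in>N. (u, v) \<in> X}"
      have "(\<Sum>p\<in>X. weight (subdivided_edge P (Inl u) (Inr p)) * f (Inr p)) =
          (\<Sum>p\<in>Pair u ` ?X. weight (subdivided_edge P (Inl u) (Inr p)) * f (Inr p))"
      proof (intro sum.mono_neutral_right finX ballI)
        show "Pair u ` ?X \<subseteq> X" by blast
        fix p assume p: "p \<in> X - Pair u ` ?X"
        then have "fst p \<noteq> u" using X_sub by (cases p) auto
        then show "weight (subdivided_edge P (Inl u) (Inr p)) * f (Inr p) = 0"
          by (cases p) simp
      qed
      also have "\<dots> = (\<Sum>v\<in>?X. weight (edge P u v) * path_sum P v t)"
        by (subst sum.reindex) (auto simp: f_def inj_on_def single_one)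
      also have "\<dots> = (\<Sum>v\<in>N. if (u, v) \<in> X then weight (edge P u v) * path_sum P v t else 0)"
        using fin by (simp add: sum.inter_filter)
      finally have "(\<Sum>y\<in>V. weight (subdivided_edge P (Inl u) y) * f y) =
          (\<Sum>v\<in>N. weight (subdivided_edge P (Inl u) (Inl v)) * path_sum P v t
             + (if (u, v) \<in> X then weight (edge P u v) * path_sum P v t else 0))"
        by (simp add: sumV sum.distrib f_def del: subdivided_edge.simps)
      also have "\<dots> = (\<Sum>v\<in>N. weight (edge P u v) * path_sum P v t)"
        by (rule sum.cong) (auto simp: X_def split: option.splits label.splits)
      finally show ?thesis
        using path_sum_forward[OF dag, of u t] u by (simp add: f_def N_def Inl)
    next
      case (Inr p)
      obtain u v where p: "p = (u, v)" by (cases p)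
      with Inr x have uv: "(u, v) \<in> X" by (auto simp: V_def)
      have "(\<Sum>y\<in>V. weight (subdivided_edge P x y) * f y) =
          (\<Sum>w\<in>N. if w = v then weight (edge P u v) * path_sum P v t else 0)"
        unfolding sumV by (auto simp: Inr p f_def intro!: sum.cong)
      then show ?thesis
        using uv X_sub fin by (auto simp: f_def Inr p)
    qed
  qed
  then have poly: "abp_poly Q = abp_poly P"
    by (simp add: abp_poly_eq_path_sum s_def t_def f_def)
  have reads: "i \<in> {1..n} \<and> l = \<rho> i * M" if rd: "reads_in_layer Q l i" for l i
  proof -
    obtain x y where xy: "subdivided_edge P x y = Some (Var i)" "lay x = l"
      using rd unfolding Q_def by (rule reads_in_layer_mk_abpE)
    then show ?thesis
      using eVar
      by (cases "(P, x, y)" rule: subdivided_edge.cases)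
        (auto simp: lay_def split: if_splits option.splits label.splits)
  qed
  have "M > 0" by (simp add: M_def)
  have "is_roabp n Q"
  proof (rule is_roabpI[OF absQ])
    show "i = j" if "reads_in_layer Q l i" "reads_in_layer Q l j" for l i j
      using reads[OF that(1)] reads[OF that(2)] \<open>M > 0\<close> inj by (auto dest: inj_onD)
    show "l = m" if "reads_in_layer Q l i" "reads_in_layer Q m i" for l m i
      using reads[OF that(1)] reads[OF that(2)] by simp
  qed
  moreover have "abp_size Q \<le> abp_size P + abp_size P ^ 2"
  proof -
    have "card X \<le> card (N \<times> N)"
      using X_sub fin by (intro card_mono) auto
    moreover have "card V \<le> card (Inl ` N :: (nat + nat \<times> nat) set) + card (Inr ` X :: (nat + nat \<times> nat) set)"
      unfolding V_def by (rule card_Un_le)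
    ultimately show ?thesis
      by (simp add: Q_def abp_size_def N_def card_image card_cartesian_product power2_eq_square)
  qed
  ultimately show ?thesis
    using poly by blast
qed

section \<open>Joining a program with a reversed program\<close>

definition restrict_edges :: "'a abp \<Rightarrow> (nat \<times> nat) set \<Rightarrow> 'a abp" where
  "restrict_edges P S = P\<lparr>edge := (\<lambda>u v. if (u, v) \<in> S then edge P u v else None)\<rparr>"

lemma restrict_edges_simps [simp]:
  "nodes (restrict_edges P S) = nodes P"
  "layer (restrict_edges P S) = layer P"
  "edge (restrict_edges P S) u v = (if (u, v) \<in> S then edge P u v else None)"
  by (simp_all add: restrict_edges_def)

lemma dag_restrict_edges: "dag P \<Longrightarrow> dag (restrict_edges P S)"
  by (auto simp: dag_def)

text \<open>Both copies contain the old source and the old sink, and the reversed one runs from the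
  latter to the former, so fresh ends are attached.\<close>

datatype join_node = Start | End | Up nat | Down nat

instance join_node :: countable
  by countable_datatype

text \<open>If \<open>b\<close> is false, the reversed copy has no entrance and contributes
  nothing.\<close>

fun join_edge :: "'a::one abp \<Rightarrow> (nat \<times> nat) set \<Rightarrow> (nat \<times> nat) set \<Rightarrow> bool
    \<Rightarrow> join_node \<Rightarrow> join_node \<Rightarrow> 'a label option" where
  "join_edge P S T b Start (Up v) = (if v = source P then Some (Const 1) else None)"
| "join_edge P S T b Start (Down v) = (if b \<and> v = sink P then Some (Const 1) else None)"
| "join_edge P S T b (Up u) (Up v) = (if (u, v) \<in> S then edge P u v else None)"
| "join_edge P S T b (Down v) (Down u) = (if (u, v) \<in> T then edge P u v else None)"
| "join_edge P S T b (Up v) End = (if v = sink P then Some (Const 1) else None)"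
| "join_edge P S T b (Down v) End = (if v = source P then Some (Const 1) else None)"
| "join_edge P S T b _ _ = None"

lemma ordered_join:
  fixes P :: "'a::comm_ring_1 abp"
  assumes abp: "is_abp n P"
    and le_n: "\<forall>v. p v \<le> n" "\<forall>v. q v \<le> n"
    and p: "\<forall>u v. (u, v) \<in> S \<longrightarrow> fits \<rho> (edge P u v) (p u) (p v)"
    and q: "\<forall>u v. (u, v) \<in> T \<longrightarrow> fits \<rho> (edge P u v) (q v) (q u)"
  shows "\<exists>(Q :: 'a abp) pos. is_abp n Q \<and> ordered_by \<rho> pos Q \<and>
    abp_poly Q = path_sum (restrict_edges P S) (source P) (sink P) +
      (if b then path_sum (restrict_edges P T) (source P) (sink P) else 0) \<and>
    abp_size Q \<le> 4 * abp_size P"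
proof -
  define N L where "N = nodes P" and "L = layer P"
  define s t where "s = source P" and "t = sink P"
  have dag: "dag P"
    using abp by (rule is_abp_dag)
  have fin: "finite N" and sN: "s \<in> N" and tN: "t \<in> N"
    and tL: "\<And>v. v \<in> N \<Longrightarrow> v \<noteq> t \<Longrightarrow> L v < L t"
    and eVar: "\<And>u v i. edge P u v = Some (Var i) \<Longrightarrow> i \<in> {1..n}"
    using abp by (auto simp: is_abp_def N_def L_def s_def t_def)
  have eN: "u \<in> N \<and> v \<in> N \<and> L u < L v" if "edge P u v = Some l" for u v l
    using dag_edgeD[OF dag that] by (simp add: N_def L_def)
  have L_le: "L v \<le> L t" if "v \<in> N" for v
    using tL that by (cases "v = t") (auto intro: less_imp_le)
  define V where "V = {Start, End} \<union> (Up ` N \<union> Down ` N)"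
  \<comment> \<open>The layers of the reversed copy are reflected. No node has a layer above
    \<open>L t\<close>, so the subtraction is exact.\<close>
  define lay where "lay x = (case x of Start \<Rightarrow> 0 | End \<Rightarrow> L t + 2 | Up v \<Rightarrow> 1 + L v
      | Down v \<Rightarrow> 1 + (L t - L v))" for x
  \<comment> \<open>Position \<open>n\<close> at \<open>End\<close> dominates the positions in both
    copies.\<close>
  define ps where "ps x = (case x of Start \<Rightarrow> 0 | End \<Rightarrow> n | Up v \<Rightarrow> p v | Down v \<Rightarrow> q v)" for x
  define E where "E = join_edge P S T b"
  define Q where "Q = mk_abp V lay E Start End"
  have V_less_End: "lay x < lay End" if "x \<in> V" "x \<noteq> End" for x
    using that L_le by (auto simp: V_def lay_def less_Suc_eq_le)
  have finV: "finite V"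
    using fin by (simp add: V_def)
  have absQ: "is_abp n Q"
    unfolding Q_def
  proof (rule is_abp_mk_abp)
    show "Start \<in> V" "End \<in> V"
      by (auto simp: V_def)
    show "lay Start < lay x" if "x \<in> V" "x \<noteq> Start" for x
      using that by (auto simp: V_def lay_def)
    show "lay x < lay End" if "x \<in> V" "x \<noteq> End" for x
      using that by (rule V_less_End)
    show "lay x < lay y" if "x \<in> V" "y \<in> V" "E x y = Some l" for x y l
    proof (cases "y = End")
      case True
      then have "x \<noteq> End"
        using that(3) by (auto simp: E_def)
      then show ?thesis
        using True V_less_End that(1) by simp
    next
      case False
      show ?thesis
        using that(3) False L_le eN
        by (cases "(P, S, T, b, x, y)" rule: join_edge.cases)
          (fastforce simp: E_def lay_def intro: diff_less_mono2 split: if_splits)+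
    qed
    show "i \<in> {1..n}" if "E x y = Some (Var i)" for x y i
      using that eVar unfolding E_def
      by (cases "(P, S, T, b, x, y)" rule: join_edge.cases) (auto split: if_splits)
  qed (rule finV)
  have "fits \<rho> (E x y) (ps x) (ps y)" for x y
    unfolding E_def using p q le_n
    by (cases "(P, S, T, b, x, y)" rule: join_edge.cases) (auto simp: ps_def fits_def)
  then have "ordered_by \<rho> (\<lambda>a. ps (from_nat a)) Q"
    unfolding ordered_by_def Q_def using le_n
    by (auto simp: V_def ps_def mk_abp_def fits_def)
  \<comment> \<open>From \<open>Down v\<close> the edges between \<open>s\<close> and
    \<open>v\<close> are still ahead, which gives the path sum from \<open>s\<close> to
    \<open>v\<close>; its recursion is the backward one.\<close>
  moreover define f where "f x = (case x of
      Start \<Rightarrow> path_sum (restrict_edges P S) s t + (if b then path_sum (restrict_edges P T) s t else 0)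
    | End \<Rightarrow> 1 | Up v \<Rightarrow> path_sum (restrict_edges P S) v t
    | Down v \<Rightarrow> path_sum (restrict_edges P T) s v)" for x
  have sumV: "sum g V = g Start + g End + (\<Sum>v\<in>N. g (Up v)) + (\<Sum>v\<in>N. g (Down v))"
    for g :: "join_node \<Rightarrow> 'a mpoly"
  proof -
    have "sum g V = sum g {Start, End} + sum g (Up ` N \<union> Down ` N)"
      unfolding V_def using fin by (intro sum.union_disjoint) auto
    also have "sum g (Up ` N \<union> Down ` N) = sum g (Up ` N) + sum g (Down ` N)"
      using fin by (intro sum.union_disjoint) auto
    finally show ?thesis
      by (simp add: sum.reindex inj_on_def add_ac)
  qed
  have "abp_poly Q = f Start"
    unfolding Q_def
  proof (rule abp_poly_mk_abp[OF absQ[unfolded Q_def]])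
    fix x assume x: "x \<in> V"
    show "f x = (if x = End then 1 else 0) + (\<Sum>y\<in>V. weight (E x y) * f y)"
    proof (cases x)
      case Start
      have 1: "(\<Sum>v\<in>N. weight (E Start (Up v)) * f (Up v)) = f (Up s)"
        using fin sN
        by (subst sum.remove[of _ s]) (auto simp: E_def s_def single_one intro!: sum.neutral)
      have 2: "(\<Sum>v\<in>N. weight (E Start (Down v)) * f (Down v)) = (if b then f (Down t) else 0)"
        using fin tN
        by (subst sum.remove[of _ t]) (auto simp: E_def t_def single_one intro!: sum.neutral)
      show ?thesis
        by (simp add: Start sumV 1 2) (simp add: E_def f_def)
    next
      case End
      then show ?thesis
        by (simp add: sumV E_def f_def)
    next
      case (Up u)
      then have "u \<in> N" using x by (auto simp: V_def)
      then show ?thesis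
        using path_sum_forward[OF dag_restrict_edges[OF dag, of S], of u t]
        by (simp add: Up sumV E_def f_def N_def t_def single_one)
    next
      case (Down u)
      then have "u \<in> N" using x by (auto simp: V_def)
      then show ?thesis
        using path_sum_backward[OF dag_restrict_edges[OF dag, of T], of s u] sN
        by (auto simp: Down sumV E_def f_def N_def s_def single_one)
    qed
  qed
  moreover have "abp_size Q \<le> 4 * abp_size P"
  proof -
    have "card V \<le> card {Start, End} + card (Up ` N \<union> Down ` N)"
      unfolding V_def by (rule card_Un_le)
    also have "card (Up ` N \<union> Down ` N) \<le> card (Up ` N) + card (Down ` N)"
      by (rule card_Un_le)
    finally have "card V \<le> 2 + (card N + card N)"
      by (simp add: card_image inj_on_def)
    moreover have "card N \<ge> 1"
      using sN fin by (metis One_nat_def Suc_leI card_gt_0_iff empty_iff)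
    ultimately show ?thesis
      by (simp add: Q_def abp_size_def N_def card_image)
  qed
  ultimately show ?thesis
    using absQ by (auto simp: f_def s_def t_def)
qed

section \<open>Decomposing a strict-interval program\<close>

text \<open>If \<open>y' \<le> x'\<close> although \<open>x < y\<close>, then
  \<open>max x y'\<close> lies in both intervals.\<close>

lemma disjoint_intervals_less:
  fixes x :: "'a::linorder"
  assumes "{i..j} \<inter> {k..l} = {}" "x \<in> {i..j}" "x' \<in> {i..j}" "y \<in> {k..l}" "y' \<in> {k..l}" "x < y"
  shows "x' < y'"
proof (rule ccontr)
  assume "\<not> x' < y'"
  then have "max x y' \<in> {i..j} \<inter> {k..l}"
    using assms(2-6) by (auto simp: max_def)
  with assms(1) show False by blast
qed

text \<open>Whether a node is up or down does not depend on the path through it, so the paths can be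
  divided by restricting the edges. \<open>p\<close> and \<open>q\<close> are the positions in the
  two copies, and \<open>b\<close> tells whether the paths in \<open>T\<close> count.\<close>

lemma strict_interval_decomposition:
  fixes P :: "'a::comm_ring_1 abp"
  assumes P: "strict_interval_abp n P \<pi>"
  shows "\<exists>\<rho> p q S T b. inj_on \<rho> {1..n} \<and> (\<forall>v. p v \<le> n) \<and> (\<forall>v. q v \<le> n) \<and>
    (\<forall>u v. (u, v) \<in> S \<longrightarrow> fits \<rho> (edge P u v) (p u) (p v)) \<and>
    (\<forall>u v. (u, v) \<in> T \<longrightarrow> fits \<rho> (edge P u v) (q v) (q u)) \<and>
    abp_poly P = path_sum (restrict_edges P S) (source P) (sink P) +
      (if b then path_sum (restrict_edges P T) (source P) (sink P) else 0)"
proof -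
  define N where "N = nodes P"
  define s t where "s = source P" and "t = sink P"
  have abp: "is_abp n P" and \<pi>: "\<pi> permutes {1..n}"
    using P by (auto simp: strict_interval_abp_def)
  have dag: "dag P"
    using abp by (rule is_abp_dag)
  have fin: "finite N" and sN: "s \<in> N" and tN: "t \<in> N"
    and eVar: "\<And>u v i. edge P u v = Some (Var i) \<Longrightarrow> i \<in> {1..n}"
    using abp by (auto simp: is_abp_def N_def s_def t_def)
  define R where "R = (edges P)\<^sup>*"
  \<comment> \<open>For edges between these nodes, the variable on the edge lies before its head and
    after its tail.\<close>
  define A where "A = {v \<in> N. (s, v) \<in> R \<and> (v, t) \<in> R}"
  define before where "before v = abp_vars (subprogram P s v)" for v
  define after where "after v = abp_vars (subprogram P v t)" for v
  define \<rho> where "\<rho> = inv \<pi>"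
  have \<rho>: "\<rho> permutes {1..n}"
    unfolding \<rho>_def using \<pi> by (rule permutes_inv)
  have \<rho>\<pi>: "\<rho> (\<pi> k) = k" for k
    unfolding \<rho>_def using \<pi> by (simp add: permutes_inverses)
  have before_iff: "i \<in> before v \<longleftrightarrow>
      (\<exists>a b. edge P a b = Some (Var i) \<and> (s, a) \<in> R \<and> (b, v) \<in> R)" for i v
    unfolding before_def R_def by (rule abp_vars_subprogram_iff[OF dag])
  have after_iff: "i \<in> after v \<longleftrightarrow>
      (\<exists>a b. edge P a b = Some (Var i) \<and> (v, a) \<in> R \<and> (b, t) \<in> R)" for i v
    unfolding after_def R_def by (rule abp_vars_subprogram_iff[OF dag])
  have R_edge: "(u, v) \<in> R" if "edge P u v = Some l" for u v l
    using that unfolding R_def by (intro r_into_rtrancl) (simp add: edges_iff)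
  have R_trans: "(u, w) \<in> R" if "(u, v) \<in> R" "(v, w) \<in> R" for u v w
    using that unfolding R_def by (rule rtrancl_trans)
  have R_refl: "(u, u) \<in> R" for u
    by (simp add: R_def)
  have before_mono: "before u \<subseteq> before v" and after_mono: "after v \<subseteq> after u"
    if "edge P u v = Some l" for u v l
    using R_trans[OF _ R_edge[OF that]] R_trans[OF R_edge[OF that]]
    unfolding subset_iff before_iff after_iff by blast+
  have before_Var: "i \<in> before v" if "edge P u v = Some (Var i)" "u \<in> A" for u v i
    using that R_refl by (auto simp: before_iff A_def)
  have after_Var: "i \<in> after u" if "edge P u v = Some (Var i)" "v \<in> A" for u v i
    using that R_refl by (auto simp: after_iff A_def)
  have before_sub: "before v \<subseteq> {1..n}" and after_sub: "after v \<subseteq> {1..n}" for v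
    using eVar by (auto simp: before_iff after_iff)
  have fin_ba: "finite (before v)" "finite (after v)" for v
    using finite_subset[OF before_sub] finite_subset[OF after_sub] by auto
  have R_layer: "layer P u \<le> layer P v" if "(u, v) \<in> R" for u v
    using that unfolding R_def by (rule rtrancl_edges_layer_le[OF dag])
  have acyclic: False if "edge P a b = Some l" "(v, a) \<in> R" "(b, v) \<in> R" for a b v l
    using R_layer[OF that(2)] R_layer[OF that(3)] dag_edgeD(3)[OF dag that(1)] by simp
  have before_s: "before s = {}" and after_t: "after t = {}"
    using acyclic unfolding set_eq_iff empty_iff before_iff after_iff by blast+

  define up where "up v \<longleftrightarrow> (\<forall>x\<in>before v. \<forall>y\<in>after v. \<rho> x < \<rho> y)" for v
  define down where "down v \<longleftrightarrow> (\<forall>x\<in>before v. \<forall>y\<in>after v. \<rho> y < \<rho> x)" for v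
  define late where "late v \<longleftrightarrow> before v \<noteq> {} \<and> after v = {}" for v
  have up_or_down: "up v \<or> down v" if v: "v \<in> N" for v
  proof -
    obtain I where I: "is_pi_interval n \<pi> (I s v)" "is_pi_interval n \<pi> (I v t)"
      "before v \<subseteq> I s v" "after v \<subseteq> I v t" "I s v \<inter> I v t = {}"
      using P v sN tN unfolding strict_interval_abp_def N_def before_def after_def by metis
    then obtain i j k l where ij: "I s v = \<pi> ` {i..j}" and kl: "I v t = \<pi> ` {k..l}"
      unfolding is_pi_interval_def by blast
    have disj: "{i..j} \<inter> {k..l} = {}"
      using I(5) unfolding ij kl by blast
    have "\<rho> x \<in> {i..j}" if "x \<in> before v" for x
      using that I(3) \<rho>\<pi> unfolding ij by fastforce
    moreover have "\<rho> y \<in> {k..l}" if "y \<in> after v" for y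
      using that I(4) \<rho>\<pi> unfolding kl by fastforce
    \<comment> \<open>One pair decides the order of all pairs; if there is no pair, both
      alternatives hold.\<close>
    ultimately show ?thesis
      unfolding up_def down_def using disj disjoint_intervals_less[OF disj]
      by (metis disjoint_iff linorder_neqE_nat)
  qed
  have not_both: "before v = {} \<or> after v = {}" if "up v" "down v" for v
    using that unfolding up_def down_def by (metis all_not_in_conv less_asym')

  define S where "S = {(u, v). u \<in> A \<and> v \<in> A \<and> up u \<and> up v}"
  \<comment> \<open>Paths of up nodes only are counted by \<open>S\<close>. The last condition in \<open>T\<close> removes them from the
    reversed copy: a path in \<open>T\<close> to a late node has to visit a node that is not up.\<close>
  define T where "T = {(u, v). u \<in> A \<and> v \<in> A \<and> down u \<and> down v \<and> (late v \<longrightarrow> before u \<noteq> {})}"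
  \<comment> \<open>Ranks start at 1, so 0 is a position strictly below all of them when nothing has
    been read. In the reversed copy the variables after \<open>v\<close> are the ones already read,
    whence \<open>q\<close>.\<close>
  define p where "p v = Max (insert 0 (\<rho> ` before v))" for v
  define q where "q v = Max (insert 0 (\<rho> ` after v))" for v
  have \<rho>_le: "\<rho> i \<le> n" "\<rho> i > 0" if "i \<in> {1..n}" for i
    using that permutes_in_image[OF \<rho>, of i] by auto
  have le_n: "p v \<le> n" "q v \<le> n" for v
    using before_sub[of v] after_sub[of v] \<rho>_le fin_ba by (auto simp: p_def q_def)
  have fits_p: "fits \<rho> (edge P u v) (p u) (p v)" if uv: "(u, v) \<in> S" for u v
    unfolding fits_def
  proof (intro conjI allI impI)
    assume "edge P u v \<noteq> None"
    then obtain l where "edge P u v = Some l"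
      by auto
    then have "insert 0 (\<rho> ` before u) \<subseteq> insert 0 (\<rho> ` before v)"
      by (intro insert_mono image_mono before_mono)
    then show "p u \<le> p v"
      unfolding p_def by (rule Max_mono) (simp_all add: fin_ba)
  next
    fix i assume i: "edge P u v = Some (Var i)"
    have "\<rho> x < \<rho> i" if "x \<in> before u" for x
      using that after_Var[OF i] uv by (auto simp: S_def up_def)
    then show "p u < \<rho> i"
      using fin_ba \<rho>_le(2)[OF eVar[OF i]] by (auto simp: p_def)
    show "\<rho> i \<le> p v"
      using fin_ba before_Var[OF i] uv by (auto simp: p_def S_def)
  qed
  have fits_q: "fits \<rho> (edge P u v) (q v) (q u)" if uv: "(u, v) \<in> T" for u v
    unfolding fits_def
  proof (intro conjI allI impI)
    assume "edge P u v \<noteq> None"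
    then obtain l where "edge P u v = Some l"
      by auto
    then have "insert 0 (\<rho> ` after v) \<subseteq> insert 0 (\<rho> ` after u)"
      by (intro insert_mono image_mono after_mono)
    then show "q v \<le> q u"
      unfolding q_def by (rule Max_mono) (simp_all add: fin_ba)
  next
    fix i assume i: "edge P u v = Some (Var i)"
    have "\<rho> y < \<rho> i" if "y \<in> after v" for y
      using that before_Var[OF i] uv by (auto simp: T_def down_def)
    then show "q v < \<rho> i"
      using fin_ba \<rho>_le(2)[OF eVar[OF i]] by (auto simp: q_def)
    show "\<rho> i \<le> q u"
      using fin_ba after_Var[OF i] uv by (auto simp: q_def T_def)
  qed

  define B where "B = path_sum P s"
  define BS where "BS = path_sum (restrict_edges P S) s"
  define BT where "BT = path_sum (restrict_edges P T) s"
  have B0: "B v = 0" if "(s, v) \<notin> R" for v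
  proof -
    have "paths P s v = {}"
    proof (rule equals0I)
      fix p assume p: "p \<in> paths P s v"
      then have "v \<in> set p" by (auto simp: paths_def)
      from path_rtrancl_edges[OF p this] that show False
        by (simp add: R_def)
    qed
    then show ?thesis by (simp add: B_def path_sum_def)
  qed
  have Brec: "B v = (if s = v then 1 else 0) + (\<Sum>w\<in>N. weight (edge P w v) * B w)"
    if "v \<in> N" for v
    unfolding B_def N_def by (rule path_sum_backward) (use dag sN that in \<open>auto simp: N_def\<close>)
  have BSrec: "BS v = (if s = v then 1 else 0) +
      (\<Sum>w\<in>N. weight (if (w, v) \<in> S then edge P w v else None) * BS w)" if "v \<in> N" for v
    using path_sum_backward[OF dag_restrict_edges[OF dag, of S], of s v] sN that
    by (simp add: BS_def N_def)
  have BTrec: "BT v = (if s = v then 1 else 0) +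
      (\<Sum>w\<in>N. weight (if (w, v) \<in> T then edge P w v else None) * BT w)" if "v \<in> N" for v
    using path_sum_backward[OF dag_restrict_edges[OF dag, of T], of s v] sN that
    by (simp add: BT_def N_def)
  have AN: "v \<in> N" if "v \<in> A" for v
    using that by (simp add: A_def)
  \<comment> \<open>Such a \<open>w\<close> reaches \<open>t\<close>; if it is outside
    \<open>A\<close>, it is not reachable from \<open>s\<close> and no path is lost by dropping its
    edges.\<close>
  have pred_A: "w \<in> A \<or> B w = 0" if "edge P w v = Some l" "v \<in> A" for w v l
    using that B0[of w] R_edge[OF that(1)] R_trans dag_edgeD(1)[OF dag that(1)]
    by (auto simp: A_def N_def)

  \<comment> \<open>A node that is not late but both up and down has nothing before it, and there
    both copies count all paths. This does no harm: the two sums are added only at late nodes, where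
    the paths are really divided.\<close>
  have main: "v \<in> A \<longrightarrow> (up v \<and> \<not> late v \<longrightarrow> BS v = B v) \<and> (down v \<and> \<not> late v \<longrightarrow> BT v = B v) \<and>
      (late v \<longrightarrow> BS v + BT v = B v)" for v
  proof (induction "layer P v" arbitrary: v rule: less_induct)
    case less
    have IH: "(up w \<and> \<not> late w \<longrightarrow> BS w = B w) \<and> (down w \<and> \<not> late w \<longrightarrow> BT w = B w) \<and>
      (late w \<longrightarrow> BS w + BT w = B w)" if "edge P w v = Some l" "w \<in> A" for w l
      using less that dag_edgeD(3)[OF dag that(1)] by blast
    show ?case
    proof (intro impI conjI)
      assume v: "v \<in> A" and h: "up v \<and> \<not> late v"
      have "weight (if (w, v) \<in> S then edge P w v else None) * BS w = weight (edge P w v) * B w" for w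
      proof (cases "edge P w v")
        case (Some l)
        have bm: "before w \<subseteq> before v" and am: "after v \<subseteq> after w"
          using before_mono[OF Some] after_mono[OF Some] by auto
        show ?thesis
        proof (cases "w \<in> A")
          case True
          \<comment> \<open>A variable \<open>x\<close> before \<open>w\<close> is also before
            \<open>v\<close>, so \<open>v\<close>, not being late, has some \<open>y\<close> after
            it, which is also after \<open>w\<close>. The nodes \<open>w\<close> and
            \<open>v\<close> would order this pair in opposite ways.\<close>
          have "up w"
          proof (rule ccontr)
            assume n: "\<not> up w"
            then have "down w" using up_or_down AN True by blast
            moreover obtain x where "x \<in> before w" using n by (auto simp: up_def)
            moreover obtain y where "y \<in> after v" using h bm \<open>x \<in> before w\<close> by (auto simp: late_def)
            ultimately have "\<rho> y < \<rho> x" "\<rho> x < \<rho> y"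
              using h bm am by (auto simp: up_def down_def)
            then show False by simp
          qed
          moreover have "\<not> late w" using h bm am by (auto simp: late_def)
          ultimately show ?thesis
            using IH[OF Some True] h v True by (simp add: S_def)
        next
          case False
          then show ?thesis using pred_A[OF Some v] by (simp add: S_def)
        qed
      qed simp
      then show "BS v = B v"
        by (simp only: Brec[OF AN[OF v]] BSrec[OF AN[OF v]])
    next
      assume v: "v \<in> A" and h: "down v \<and> \<not> late v"
      have "weight (if (w, v) \<in> T then edge P w v else None) * BT w = weight (edge P w v) * B w" for w
      proof (cases "edge P w v")
        case (Some l)
        have bm: "before w \<subseteq> before v" and am: "after v \<subseteq> after w"
          using before_mono[OF Some] after_mono[OF Some] by auto
        show ?thesis
        proof (cases "w \<in> A")
          case True
          have "down w"
          proof (rule ccontr)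
            assume n: "\<not> down w"
            then have "up w" using up_or_down AN True by blast
            moreover obtain x where "x \<in> before w" using n by (auto simp: down_def)
            moreover obtain y where "y \<in> after v" using h bm \<open>x \<in> before w\<close> by (auto simp: late_def)
            ultimately have "\<rho> y < \<rho> x" "\<rho> x < \<rho> y"
              using h bm am by (auto simp: up_def down_def)
            then show False by simp
          qed
          moreover have "\<not> late w" using h bm am by (auto simp: late_def)
          ultimately show ?thesis
            using IH[OF Some True] h v True by (simp add: T_def)
        next
          case False
          then show ?thesis using pred_A[OF Some v] by (simp add: T_def)
        qed
      qed simp
      then show "BT v = B v"
        by (simp only: Brec[OF AN[OF v]] BTrec[OF AN[OF v]])
    next
      assume v: "v \<in> A" and h: "late v"
      then have "s \<noteq> v" using before_s by (auto simp: late_def)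
      have ud: "up v" "down v" using h by (auto simp: late_def up_def down_def)
      have "weight (if (w, v) \<in> S then edge P w v else None) * BS w
          + weight (if (w, v) \<in> T then edge P w v else None) * BT w = weight (edge P w v) * B w" for w
      proof (cases "edge P w v")
        case (Some l)
        show ?thesis
        proof (cases "w \<in> A")
          case True
          note IHw = IH[OF Some True]
          \<comment> \<open>A late predecessor passes on both of its sums. One with nothing before
            it counts through \<open>S\<close> only, by the last condition in \<open>T\<close>. Any
            other is either up or down, not both, and counts through exactly one of the edge
            sets.\<close>
          consider "late w" | "before w = {}" | "before w \<noteq> {}" "after w \<noteq> {}"
            by (auto simp: late_def)
          then show ?thesis
          proof cases
            case 1
            then have "up w" "down w" "before w \<noteq> {}" by (auto simp: late_def up_def down_def)
            then have "(w, v) \<in> S" "(w, v) \<in> T" using v True ud by (auto simp: S_def T_def)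
            then show ?thesis using IHw 1 by (simp flip: distrib_left)
          next
            case 2
            then have "up w" "\<not> late w" by (auto simp: late_def up_def)
            moreover have "(w, v) \<in> S" "(w, v) \<notin> T"
              using v True ud \<open>up w\<close> h 2 by (auto simp: S_def T_def)
            ultimately show ?thesis using IHw by simp
          next
            case 3
            then have nl: "\<not> late w" by (simp add: late_def)
            show ?thesis
            proof (cases "up w")
              case up: True
              then have "\<not> down w" using not_both 3 by blast
              then have "(w, v) \<in> S" "(w, v) \<notin> T" using v True ud up by (auto simp: S_def T_def)
              then show ?thesis using IHw up nl by simp
            next
              case False
              then have dn: "down w" using up_or_down AN True by blast
              have "(w, v) \<notin> S" "(w, v) \<in> T" using v True ud False dn 3 by (auto simp: S_def T_def)
              then show ?thesis using IHw dn nl by simp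
            qed
          qed
        next
          case False
          then show ?thesis using pred_A[OF Some v] by (simp add: S_def T_def)
        qed
      qed simp
      then show "BS v + BT v = B v"
        using Brec[OF AN[OF v]] BSrec[OF AN[OF v]] BTrec[OF AN[OF v]] \<open>s \<noteq> v\<close>
        by (simp flip: sum.distrib)
    qed
  qed
  \<comment> \<open>Nothing is after the sink, so it is up. If it is not late, nothing is before it
    either and the up copy already counts every path. If \<open>s\<close> does not reach
    \<open>t\<close>, both sides are 0.\<close>
  have "B t = BS t + (if late t then BT t else 0)"
  proof (cases "t \<in> A")
    case True
    have "up t" using after_t by (simp add: up_def)
    then show ?thesis using main[of t] True by auto
  next
    case False
    then have st: "(s, t) \<notin> R"
      using tN R_refl by (auto simp: A_def)
    then have "s \<noteq> t" using R_refl by auto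
    have "before t = {}"
      using st R_trans R_edge unfolding before_iff set_eq_iff by (metis empty_iff)
    moreover have "BS t = 0"
      using BSrec[OF tN] \<open>s \<noteq> t\<close> False by (simp add: S_def)
    ultimately show ?thesis
      using B0[OF st] by (simp add: late_def)
  qed
  then have poly: "abp_poly P = path_sum (restrict_edges P S) (source P) (sink P) +
      (if late t then path_sum (restrict_edges P T) (source P) (sink P) else 0)"
    by (simp add: abp_poly_eq_path_sum B_def BS_def BT_def s_def t_def)
  have inj: "inj_on \<rho> {1..n}"
    using \<rho> by (rule permutes_inj_on)
  show ?thesis
    by (rule exI[of _ \<rho>], rule exI[of _ p], rule exI[of _ q], rule exI[of _ S],
        rule exI[of _ T], rule exI[of _ "late t"])
      (use inj le_n fits_p fits_q poly in simp)
qed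

text \<open>Joining gives at most \<open>4 * S\<close> nodes for size \<open>S\<close>, and
  subdividing adds at most the square of that; \<open>4 * S + 16 * S ^ 2\<close> is at most
  \<open>20 * S ^ 2\<close>.\<close>

lemma strict_interval_to_roabp:
  fixes P :: "'a::comm_ring_1 abp"
  assumes P: "strict_interval_abp n P \<pi>"
  shows "\<exists>Q :: 'a abp. is_roabp n Q \<and> abp_poly Q = abp_poly P \<and> abp_size Q \<le> 20 * abp_size P ^ 2"
proof -
  obtain \<rho> p q S T b where inj: "inj_on \<rho> {1..n}"
    and pq: "\<forall>v. p v \<le> n" "\<forall>v. q v \<le> n"
      "\<forall>u v. (u, v) \<in> S \<longrightarrow> fits \<rho> (edge P u v) (p u) (p v)"
      "\<forall>u v. (u, v) \<in> T \<longrightarrow> fits \<rho> (edge P u v) (q v) (q u)"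
    and poly: "abp_poly P = path_sum (restrict_edges P S) (source P) (sink P) +
      (if b then path_sum (restrict_edges P T) (source P) (sink P) else 0)"
    using strict_interval_decomposition[OF P] by (elim exE conjE) (rule that)
  have abp: "is_abp n P"
    using P by (simp add: strict_interval_abp_def)
  obtain H :: "'a abp" and pos where H: "is_abp n H" "ordered_by \<rho> pos H"
    "abp_poly H = abp_poly P" "abp_size H \<le> 4 * abp_size P"
    using ordered_join[OF abp pq, where b = b] unfolding poly[symmetric] by (elim exE conjE) (rule that)
  obtain Q :: "'a abp" where Q: "is_roabp n Q" "abp_poly Q = abp_poly H"
    "abp_size Q \<le> abp_size H + abp_size H ^ 2"
    using ordered_abp_to_roabp[OF H(1,2) inj] by blast
  have "abp_size H ^ 2 \<le> (4 * abp_size P) ^ 2"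
    using H(4) by (rule power_mono) simp
  moreover have "abp_size P \<le> abp_size P ^ 2"
    by (simp add: power2_eq_square)
  ultimately have "abp_size Q \<le> 20 * abp_size P ^ 2"
    using Q(3) H(4) by (simp add: power_mult_distrib)
  then show ?thesis
    using Q(1,2) H(3) by auto
qed

theorem mainTheorem5:
  shows "(\<exists>C. \<forall>n (P :: 'a::field abp) \<pi>. strict_interval_abp n P \<pi> \<longrightarrow>
            (\<exists>Q :: 'a abp. is_roabp n Q \<and> abp_poly Q = abp_poly P \<and>
               abp_size Q \<le> C * abp_size P ^ 2))
       \<and> (\<exists>C d. \<forall>n (P :: 'a abp) \<pi>. strict_interval_abp n P \<pi> \<longrightarrow>
            (\<exists>Q :: 'a abp. is_roabp n Q \<and> adjacent_layers Q \<and> abp_poly Q = abp_poly P \<and>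
               abp_size Q \<le> C * abp_size P ^ d))
       \<and> (\<exists>C d. \<forall>n (Q :: 'a abp). is_roabp n Q \<longrightarrow>
            (\<exists>(P :: 'a abp) \<pi>. strict_interval_abp n P \<pi> \<and> adjacent_layers P \<and>
               abp_poly P = abp_poly Q \<and> abp_size P \<le> C * abp_size Q ^ d))"
proof (intro conjI)
  show "\<exists>C. \<forall>n (P :: 'a abp) \<pi>. strict_interval_abp n P \<pi> \<longrightarrow>
            (\<exists>Q :: 'a abp. is_roabp n Q \<and> abp_poly Q = abp_poly P \<and>
               abp_size Q \<le> C * abp_size P ^ 2)"
    using strict_interval_to_roabp by blast
  show "\<exists>C d. \<forall>n (P :: 'a abp) \<pi>. strict_interval_abp n P \<pi> \<longrightarrow>
            (\<exists>Q :: 'a abp. is_roabp n Q \<and> adjacent_layers Q \<and> abp_poly Q = abp_poly P \<and>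
               abp_size Q \<le> C * abp_size P ^ d)"
  \<comment> \<open>Making the layers adjacent squares the bound
    \<open>20 * abp_size P ^ 2\<close>.\<close>
  proof (rule exI[of _ 400], rule exI[of _ 4], intro allI impI)
    fix n \<pi> and P :: "'a abp"
    assume "strict_interval_abp n P \<pi>"
    from strict_interval_to_roabp[OF this] obtain Q :: "'a abp"
      where Q: "is_roabp n Q" "abp_poly Q = abp_poly P" "abp_size Q \<le> 20 * abp_size P ^ 2"
      by blast
    from roabp_adjacent[OF Q(1)] obtain Q' :: "'a abp"
      where Q': "is_roabp n Q'" "adjacent_layers Q'" "abp_poly Q' = abp_poly Q"
        "abp_size Q' \<le> abp_size Q ^ 2"
      by blast
    have "abp_size Q' \<le> (20 * abp_size P ^ 2) ^ 2"
      using Q'(4) power_mono[OF Q(3), of 2] by simp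
    also have "\<dots> = 400 * abp_size P ^ 4"
      by (simp add: power_mult_distrib flip: power_mult)
    finally show "\<exists>Q :: 'a abp. is_roabp n Q \<and> adjacent_layers Q \<and> abp_poly Q = abp_poly P \<and>
        abp_size Q \<le> 400 * abp_size P ^ 4"
      using Q(2) Q'(1-3) by auto
  qed
  show "\<exists>C d. \<forall>n (Q :: 'a abp). is_roabp n Q \<longrightarrow>
            (\<exists>(P :: 'a abp) \<pi>. strict_interval_abp n P \<pi> \<and> adjacent_layers P \<and>
               abp_poly P = abp_poly Q \<and> abp_size P \<le> C * abp_size Q ^ d)"
  \<comment> \<open>The whole cost is that of making the layers adjacent; the resulting ROABP is
    itself a strict-interval program.\<close>
  proof (rule exI[of _ 1], rule exI[of _ 2], intro allI impI)
    fix n and Q :: "'a abp"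
    assume "is_roabp n Q"
    from roabp_adjacent[OF this] obtain P :: "'a abp"
      where P: "is_roabp n P" "adjacent_layers P" "abp_poly P = abp_poly Q"
        "abp_size P \<le> abp_size Q ^ 2"
      by blast
    with roabp_strict_interval[OF P(1)]
    show "\<exists>(P :: 'a abp) \<pi>. strict_interval_abp n P \<pi> \<and> adjacent_layers P \<and>
        abp_poly P = abp_poly Q \<and> abp_size P \<le> 1 * abp_size Q ^ 2"
      by auto
  qed
qed

end
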